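(* Let $\sigma$ be a primitive substitution in $\mathbb{R}^2$ with prototiles $P_1,\ldots,P_m$, and let $\mathcal{T}\in\mathbb{X}_\sigma$. Let $i\in\{1,\ldots,m\}$ and $\alpha,\beta\in[0,2\pi[$. If $\mathrm{freq}(P_i,\alpha,\mathcal{T})\neq 0$ and $\mathrm{freq}(P_i,\beta,\mathcal{T})\neq 0$, then $\mathrm{freq}(P_i,\alpha,\mathcal{T})=\mathrm{freq}(P_i,\beta,\mathcal{T})$.
   Context: Prototiles and tiles. The prototiles $P_1,\ldots,P_m$ are compact subsets of $\mathbb{R}^2$, each equal to the closure of its interior. A tile is a set of the form $R_\alpha P_i+t$, where $R_\alpha$ is the rotation about the origin through the angle $\alpha\in[0,2\pi[$ and $t\in\mathbb{R}^2$. Two prototiles may be congruent as sets; in that case they carry distinguishing decorations (colours), every tile carries the decoration of its prototile, and "congruent"/equality of tiles always means with respect to decorations. A tiling is a collection of tiles covering $\mathbb{R}^2$ such that every $x\in\mathbb{R}^2$ lies in the interior of at most one tile. Substitutions. A substitution $\sigma$ with inflation factor $\lambda>1$ maps each prototile $P_i$ to a finite non-overlapping collection $\sigma(P_i)$ of tiles, each congruent to some prototile, and is assumed selfsimilar: $\lambda P_i=\bigcup_{T\in\sigma(P_i)}T$ for $1\le i\le m$. It extends to tiles by $\sigma(RP_i+t)=R\,\sigma(P_i)+\lambda t$ ($R$ a rotation, $t\in\mathbb{R}^2$) and to finite or infinite collections of tiles by $\sigma(\{T_1,T_2,\ldots\})=\sigma(T_1)\cup\sigma(T_2)\cup\cdots$.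 The collections $\sigma^k(P_i)$ are the $k$-th order supertiles. The substitution matrix $M_\sigma$ is the $m\times m$ matrix with $(M_\sigma)_{ij}=\#\{T\in\sigma(P_j): T=RP_i+t \text{ for some rotation } R \text{ and } t\in\mathbb{R}^2\}$. The substitution $\sigma$ is primitive if $M_\sigma^k$ is strictly positive for some $k\ge1$. Substitution tilings. A tiling $\mathcal{T}$ is a substitution tiling with substitution $\sigma$ if for every finite subset $\mathcal{F}\subset\mathcal{T}$ there are $i,k$ such that a congruent copy of $\mathcal{F}$ is contained in the supertile $\sigma^k(P_i)$. The family of all such tilings is denoted $\mathbb{X}_\sigma$. Frequencies. For $\mathcal{T}\in\mathbb{X}_\sigma$ and $\alpha\in[0,2\pi[$, $$\mathrm{freq}(P_i,\alpha,\mathcal{T})=\lim_{r\to\infty}\frac{\#\{T\in\mathcal{T}\cap B_r:\ \exists\, t\in\mathbb{R}^2,\ T=R_\alpha P_i+t\}}{\#\{T\in\mathcal{T}\cap B_r\}},$$ where $B_r$ is the closed ball of radius $r$ around the origin and $\mathcal{T}\cap B_r$ denotes the set of tiles of $\mathcal{T}$ contained in $B_r$. For primitive substitution tilings this limit exists. *)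

theory Defs
  imports "HOL-Analysis.Analysis"
begin

text \<open>
  The prototiles are a family \<open>P :: 'm \<Rightarrow> (real^2) set\<close> indexed by a finite type, so that
  \<open>m = CARD('m)\<close>. A tile is a point set together with the index of its prototile; the index is the
  decoration. For prototiles that are not congruent the index carries no extra information, since
  then the point set determines it. A tile does \<^emph>\<open>not\<close> record the rotation angle: if a
  prototile has a rotational symmetry, then rotating it by this symmetry gives the same tile.
\<close>

type_synonym 'm tile = "'m \<times> (real^2) set"

definition rotation :: "real \<Rightarrow> real^2 \<Rightarrow> real^2" where
  "rotation \<alpha> x = vector [cos \<alpha> * x $ 1 - sin \<alpha> * x $ 2, sin \<alpha> * x $ 1 + cos \<alpha> * x $ 2]"

definition move :: "real \<Rightarrow> real^2 \<Rightarrow> 'm tile \<Rightarrow> 'm tile" where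
  "move \<alpha> t T = (fst T, (\<lambda>x. rotation \<alpha> x + t) ` snd T)"

definition prototile :: "('m \<Rightarrow> (real^2) set) \<Rightarrow> 'm \<Rightarrow> 'm tile" where
  "prototile P i = (i, P i)"

definition is_tile :: "('m \<Rightarrow> (real^2) set) \<Rightarrow> 'm tile \<Rightarrow> bool" where
  "is_tile P T \<longleftrightarrow> (\<exists>i. \<exists>\<alpha>\<in>{0..<2*pi}. \<exists>t. T = move \<alpha> t (prototile P i))"

definition nonoverlapping :: "'m tile set \<Rightarrow> bool" where
  "nonoverlapping C \<longleftrightarrow> disjoint_family_on (\<lambda>T. interior (snd T)) C"

definition is_tiling :: "('m \<Rightarrow> (real^2) set) \<Rightarrow> 'm tile set \<Rightarrow> bool" where
  "is_tiling P \<T> \<longleftrightarrow>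
     (\<forall>T\<in>\<T>. is_tile P T) \<and> (\<Union>T\<in>\<T>. snd T) = UNIV \<and> nonoverlapping \<T>"

text \<open>
  A substitution is given directly by its extension to tiles. Assumption \<open>extension\<close> is the
  defining equation of that extension, so \<open>\<sigma>\<close> is determined on all tiles by its values on the
  prototiles; for prototiles with rotational symmetries it also says that the extension is well
  defined. The values of \<open>\<sigma>\<close> on pairs that are not tiles are irrelevant.
\<close>

locale substitution =
  fixes P :: "'m::finite \<Rightarrow> (real^2) set"
    and infl :: real
    and \<sigma> :: "'m tile \<Rightarrow> 'm tile set"
  assumes compact_prototile: "compact (P i)"
    and closure_interior_prototile: "closure (interior (P i)) = P i"
    and infl_gt_1: "infl > 1"
    and finite_subst: "finite (\<sigma> (prototile P i))"
    and tiles_subst: "T \<in> \<sigma> (prototile P i) \<Longrightarrow> is_tile P T"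
    and nonoverlapping_subst: "nonoverlapping (\<sigma> (prototile P i))"
    and selfsimilar: "(\<lambda>x. infl *\<^sub>R x) ` P i = (\<Union>T\<in>\<sigma> (prototile P i). snd T)"
    and extension:
      "\<sigma> (move \<alpha> t (prototile P i)) = move \<alpha> (infl *\<^sub>R t) ` \<sigma> (prototile P i)"

definition subst_collection :: "('m tile \<Rightarrow> 'm tile set) \<Rightarrow> 'm tile set \<Rightarrow> 'm tile set" where
  "subst_collection \<sigma> C = (\<Union>T\<in>C. \<sigma> T)"

definition supertile ::
  "('m \<Rightarrow> (real^2) set) \<Rightarrow> ('m tile \<Rightarrow> 'm tile set) \<Rightarrow> nat \<Rightarrow> 'm \<Rightarrow> 'm tile set" where
  "supertile P \<sigma> k i = (subst_collection \<sigma> ^^ k) {prototile P i}"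

definition substitution_matrix ::
  "('m::finite \<Rightarrow> (real^2) set) \<Rightarrow> ('m tile \<Rightarrow> 'm tile set) \<Rightarrow> nat^'m^'m" where
  "substitution_matrix P \<sigma> =
     (\<chi> i j. card {T \<in> \<sigma> (prototile P j). \<exists>\<alpha> t. T = move \<alpha> t (prototile P i)})"

text \<open>The power is the iterated matrix product \<open>**\<close>.\<close>

definition primitive ::
  "('m::finite \<Rightarrow> (real^2) set) \<Rightarrow> ('m tile \<Rightarrow> 'm tile set) \<Rightarrow> bool" where
  "primitive P \<sigma> \<longleftrightarrow>
     (\<exists>k\<ge>1. \<forall>i j. (((**) (substitution_matrix P \<sigma>) ^^ k) (mat 1)) $ i $ j > 0)"

text \<open>
  Congruent copies are taken under rotations and translations, the motions that carry
  prototiles to tiles, and they keep decorations.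
\<close>

definition substitution_tilings ::
  "('m \<Rightarrow> (real^2) set) \<Rightarrow> ('m tile \<Rightarrow> 'm tile set) \<Rightarrow> 'm tile set set" where
  "substitution_tilings P \<sigma> =
     {\<T>. is_tiling P \<T> \<and>
        (\<forall>F. finite F \<and> F \<subseteq> \<T> \<longrightarrow> (\<exists>i k \<alpha> t. move \<alpha> t ` F \<subseteq> supertile P \<sigma> k i))}"

definition tiles_in_ball :: "'m tile set \<Rightarrow> real \<Rightarrow> 'm tile set" where
  "tiles_in_ball \<T> r = {T \<in> \<T>. snd T \<subseteq> cball 0 r}"

text \<open>
  \<open>Lim\<close> denotes an unspecified value if the limit does not exist; for tilings of a primitive
  substitution it does exist.
\<close>

definition freq :: "('m \<Rightarrow> (real^2) set) \<Rightarrow> 'm \<Rightarrow> real \<Rightarrow> 'm tile set \<Rightarrow> real" where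
  "freq P i \<alpha> \<T> =
     Lim at_top (\<lambda>r. real (card {T \<in> tiles_in_ball \<T> r. \<exists>t. T = move \<alpha> t (prototile P i)})
                     / real (card (tiles_in_ball \<T> r)))"

end

theory Submission
  imports Defs
begin

text \<open>
  Call the quotient of the number of copies of \<open>P\<^sub>i\<close> with angle \<open>\<alpha>\<close> in the \<open>k\<close>-th order supertile of a
  tile \<open>T\<close> and its area the density. The densities of order \<open>a + b\<close> are averages, with weights
  proportional to area, of the densities of order \<open>b\<close>; hence the largest change \<open>E\<^sub>k(\<theta>)\<close> of the
  density of order \<open>k\<close> under a rotation of \<open>T\<close> through \<open>\<theta>\<close> decreases in \<open>k\<close>. If the tiling contains
  copies of \<open>P\<^sub>i\<close> with angles \<open>\<alpha>\<close> and \<open>\<beta>\<close>, and \<open>\<theta> = \<alpha> - \<beta>\<close>, then by primitivity every supertile of some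
  fixed order \<open>N\<close> contains two tiles \<open>W\<close> and \<open>R\<^sub>\<theta>W + t\<close>. In the average the changes of density of these
  two tiles telescope to the change for \<open>2\<theta>\<close>, which gives
  \<open>E\<^sub>N\<^sub>+\<^sub>k(\<theta>) \<le> \<epsilon> E\<^sub>k(2\<theta>) + (1 - 2\<epsilon>) E\<^sub>k(\<theta>)\<close> and, in the limit, \<open>E(\<theta>) \<le> E(2\<theta>) / 2\<close>. The
  hypothesis passes from \<open>\<theta>\<close> to \<open>2\<theta>\<close> and \<open>E\<close> is bounded, so \<open>E(\<theta>) = 0\<close>. Decomposing large balls
  into supertiles, up to a boundary term of lower order, shows that the difference of the two
  quotients of which the frequencies are the limits tends to \<open>0\<close>. Hence the limits agree, and no
  separate proof of their existence is needed.
\<close>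

section \<open>Motions and tiles\<close>

lemma rotation_nth [simp]:
  "rotation \<alpha> x $ 1 = cos \<alpha> * x $ 1 - sin \<alpha> * x $ 2"
  "rotation \<alpha> x $ 2 = sin \<alpha> * x $ 1 + cos \<alpha> * x $ 2"
  by (simp_all add: rotation_def)

lemma rotation_rotation [simp]: "rotation \<alpha> (rotation \<beta> x) = rotation (\<alpha> + \<beta>) x"
  by (simp add: vec_eq_iff forall_2 sin_add cos_add algebra_simps)

lemma rotation_zero [simp]: "rotation 0 x = x"
  by (simp add: vec_eq_iff forall_2)

lemma linear_rotation: "linear (rotation \<alpha>)"
  by (rule linearI) (simp_all add: vec_eq_iff forall_2 algebra_simps)

lemmas rotation_add = linear_add [OF linear_rotation]
  and rotation_scaleR = linear_cmul [OF linear_rotation]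

lemma rotation_eq_iff [simp]: "rotation \<alpha> x = rotation \<alpha> y \<longleftrightarrow> x = y"
  by (metis add.left_inverse rotation_rotation rotation_zero)

lemma orthogonal_rotation: "orthogonal_transformation (rotation \<alpha>)"
proof -
  have "rotation \<alpha> v \<bullet> rotation \<alpha> w = v \<bullet> w" for v w
  proof -
    have "rotation \<alpha> v \<bullet> rotation \<alpha> w
        = ((sin \<alpha>)\<^sup>2 + (cos \<alpha>)\<^sup>2) * (v $ 1 * w $ 1 + v $ 2 * w $ 2)"
      by (simp only: inner_vec_def sum_2 rotation_nth inner_real_def power2_eq_square algebra_simps)
    then show ?thesis
      by (simp only: inner_vec_def sum_2 inner_real_def sin_cos_squared_add mult_1)
  qed
  then show ?thesis
    by (simp add: orthogonal_transformation_def linear_rotation)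
qed

lemma dist_rotation: "dist (rotation \<alpha> x + t) (rotation \<alpha> y + t) = dist x y"
  using orthogonal_rotation [of \<alpha>] by (simp add: orthogonal_transformation_isometry)

text \<open>A rotation is determined by the sine and cosine of its angle. Through
  \<open>is_tile_iff\<close> this frees tiles from any range of angles, so sums and differences of
  angles can be used without reduction.\<close>

lemma rotation_mod_2pi: "\<exists>\<beta>\<in>{0..<2*pi}. rotation \<alpha> = rotation \<beta>"
proof -
  obtain \<beta> where "0 \<le> \<beta>" "\<beta> < 2*pi" "cos \<alpha> = cos \<beta>" "sin \<alpha> = sin \<beta>"
    using sincos_total_2pi [of "cos \<alpha>" "sin \<alpha>"] by auto
  then show ?thesis
    by (intro bexI [of _ \<beta>]) (auto simp: fun_eq_iff vec_eq_iff forall_2)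
qed

lemma interior_motion: "interior ((\<lambda>x. rotation \<alpha> x + t) ` S) = (\<lambda>x. rotation \<alpha> x + t) ` interior S"
proof -
  have "(\<lambda>x. rotation \<alpha> x + t) ` A = (+) t ` (rotation \<alpha> ` A)" for A
    by (auto simp: image_image add.commute)
  then show ?thesis
    using interior_injective_linear_image [OF linear_rotation, of \<alpha>]
    by (metis interior_translation injI rotation_eq_iff)
qed

lemma closure_motion: "closure ((\<lambda>x. rotation \<alpha> x + t) ` S) = (\<lambda>x. rotation \<alpha> x + t) ` closure S"
proof -
  have "(\<lambda>x. rotation \<alpha> x + t) ` A = (+) t ` (rotation \<alpha> ` A)" for A
    by (auto simp: image_image add.commute)
  then show ?thesis
    using closure_injective_linear_image [OF linear_rotation, of \<alpha>]
    by (metis closure_translation injI rotation_eq_iff)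
qed

lemma compact_motion: "compact S \<Longrightarrow> compact ((\<lambda>x. rotation \<alpha> x + t) ` S)"
  by (intro compact_continuous_image continuous_intros linear_continuous_on
      linear_conv_bounded_linear [THEN iffD1] linear_rotation)

lemma measure_motion:
  assumes "S \<in> lmeasurable"
  shows "measure lebesgue ((\<lambda>x. rotation \<alpha> x + t) ` S) = measure lebesgue S"
proof -
  have "(\<lambda>x. rotation \<alpha> x + t) ` S = (+) t ` (rotation \<alpha> ` S)"
    by (auto simp: image_image add.commute)
  then show ?thesis
    using measure_orthogonal_image [OF orthogonal_rotation assms] by (simp add: measure_translation)
qed

lemma interior_scaleR_image:
  fixes S :: "'a::euclidean_space set"
  assumes "c \<noteq> 0"
  shows "interior ((*\<^sub>R) c ` S) = (*\<^sub>R) c ` interior S"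
  using assms by (intro interior_injective_linear_image) (auto intro: linear_scaleR injI)

lemma measure_scaleR_plane:
  fixes S :: "(real^2) set"
  shows "measure lebesgue ((*\<^sub>R) c ` S) = c\<^sup>2 * measure lebesgue S"
proof -
  have "(*\<^sub>R) c ` S = (\<lambda>x. 0 + (\<Sum>j\<in>Basis. (c * (x \<bullet> j)) *\<^sub>R j)) ` S"
    by (rule image_cong [OF refl])
      (simp add: scaleR_scaleR [symmetric] scaleR_sum_right [symmetric] euclidean_representation
        del: scaleR_scaleR)
  then show ?thesis
    using measure_lebesgue_affine [of c 0 S] by simp
qed

section \<open>The action of motions on tiles\<close>

lemma move_move: "move \<alpha> s (move \<beta> t T) = move (\<alpha> + \<beta>) (rotation \<alpha> t + s) T"
  by (simp add: move_def image_image rotation_add add.assoc)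

lemma move_0 [simp]: "move 0 0 T = T"
  by (simp add: move_def)

lemma fst_move [simp]: "fst (move \<alpha> t T) = fst T"
  by (simp add: move_def)

lemma snd_move: "snd (move \<alpha> t T) = (\<lambda>x. rotation \<alpha> x + t) ` snd T"
  by (simp add: move_def)

lemma move_inverse:
  "move (- \<alpha>) (- rotation (- \<alpha>) t) (move \<alpha> t T) = T"
  "move \<alpha> t (move (- \<alpha>) (- rotation (- \<alpha>) t) T) = T"
  by (simp_all add: move_move linear_neg [OF linear_rotation])

lemma inj_move: "inj (move \<alpha> t)"
  by (metis injI move_inverse(1))

lemma nonoverlapping_move:
  assumes "nonoverlapping C"
  shows "nonoverlapping (move \<alpha> t ` C)"
  unfolding nonoverlapping_def disjoint_family_on_def
proof (intro ballI impI)
  fix S T assume "S \<in> move \<alpha> t ` C" "T \<in> move \<alpha> t ` C" "S \<noteq> T"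
  then obtain S' T' where *: "S = move \<alpha> t S'" "T = move \<alpha> t T'" "S' \<in> C" "T' \<in> C" "S' \<noteq> T'"
    by blast
  then have "interior (snd S') \<inter> interior (snd T') = {}"
    using assms by (auto simp: nonoverlapping_def disjoint_family_on_def)
  then show "interior (snd S) \<inter> interior (snd T) = {}"
    by (auto simp: * snd_move interior_motion)
qed

lemma nonoverlapping_subset: "nonoverlapping C \<Longrightarrow> D \<subseteq> C \<Longrightarrow> nonoverlapping D"
  unfolding nonoverlapping_def by (rule disjoint_family_on_mono)

lemma nonoverlapping_eq:
  assumes "nonoverlapping C" "S \<in> C" "T \<in> C" "x \<in> interior (snd S)" "x \<in> interior (snd T)"
  shows "S = T"
  using assms unfolding nonoverlapping_def disjoint_family_on_def by blast

lemma is_tile_iff: "is_tile P T \<longleftrightarrow> (\<exists>i \<alpha> t. T = move \<alpha> t (prototile P i))"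
  unfolding is_tile_def using rotation_mod_2pi unfolding move_def by metis

lemma is_tile_move [simp]: "is_tile P (move \<alpha> t T) \<longleftrightarrow> is_tile P T"
  unfolding is_tile_iff by (metis move_inverse(1) move_move)

lemma is_tile_prototile [simp]: "is_tile P (prototile P i)"
  unfolding is_tile_iff by (metis move_0)

lemma is_tile_cases:
  assumes "is_tile P T"
  obtains \<alpha> t where "T = move \<alpha> t (prototile P (fst T))"
  using assms unfolding is_tile_iff by (metis fst_move prototile_def fst_conv)

section \<open>Iterated substitution and areas\<close>

context substitution
begin

text \<open>Supertiles are taken of arbitrary tiles, not only of prototiles as in
  \<open>supertile\<close>, so that a supertile decomposes into supertiles of lower order
  (\<open>iter_add\<close>).\<close>

definition iter :: "nat \<Rightarrow> 'm tile \<Rightarrow> 'm tile set" where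
  "iter k T = (subst_collection \<sigma> ^^ k) {T}"

lemma iter_0 [simp]: "iter 0 T = {T}"
  by (simp add: iter_def)

lemma iter_Suc: "iter (Suc k) T = (\<Union>X\<in>iter k T. \<sigma> X)"
  by (simp add: iter_def subst_collection_def)

lemma iter_add: "iter (a + b) T = (\<Union>X\<in>iter a T. iter b X)"
  by (induction b) (auto simp: iter_Suc)

text \<open>\<open>extension\<close> speaks of moved prototiles only. Composing the two motions
  suffices, since rotations commute with the inflation.\<close>

lemma subst_move:
  assumes "is_tile P T"
  shows "\<sigma> (move \<alpha> t T) = move \<alpha> (infl *\<^sub>R t) ` \<sigma> T"
proof -
  obtain \<beta> s where T: "T = move \<beta> s (prototile P (fst T))"
    using assms by (rule is_tile_cases)
  then have "\<sigma> (move \<alpha> t T) = \<sigma> (move (\<alpha> + \<beta>) (rotation \<alpha> s + t) (prototile P (fst T)))"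
    by (metis move_move)
  also have "\<dots> = move \<alpha> (infl *\<^sub>R t) ` \<sigma> (move \<beta> s (prototile P (fst T)))"
    by (simp add: extension image_image move_move rotation_scaleR algebra_simps)
  finally show ?thesis
    using T by simp
qed

lemma
  assumes "is_tile P T"
  shows finite_subst_tile: "finite (\<sigma> T)"
    and nonoverlapping_subst_tile: "nonoverlapping (\<sigma> T)"
    and selfsimilar_tile: "(\<Union>X\<in>\<sigma> T. snd X) = (*\<^sub>R) infl ` snd T"
    and is_tile_subst: "X \<in> \<sigma> T \<Longrightarrow> is_tile P X"
proof -
  obtain \<alpha> t where T: "T = move \<alpha> t (prototile P (fst T))"
    using assms by (rule is_tile_cases)
  define i where "i = fst T"
  have T: "T = move \<alpha> t (prototile P i)"
    unfolding i_def by (fact T)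
  show "finite (\<sigma> T)" "nonoverlapping (\<sigma> T)"
    using finite_subst nonoverlapping_move [OF nonoverlapping_subst] by (simp_all add: T extension)
  have "(\<Union>X\<in>\<sigma> T. snd X) = (\<lambda>x. rotation \<alpha> x + infl *\<^sub>R t) ` (\<Union>X\<in>\<sigma> (prototile P i). snd X)"
    by (auto simp: T extension snd_move)
  also have "\<dots> = (*\<^sub>R) infl ` snd T"
    unfolding selfsimilar [symmetric]
    by (simp add: T snd_move prototile_def image_image rotation_scaleR algebra_simps)
  finally show "(\<Union>X\<in>\<sigma> T. snd X) = (*\<^sub>R) infl ` snd T" .
  show "is_tile P X" if "X \<in> \<sigma> T"
    using that tiles_subst by (auto simp: T extension)
qed

lemma is_tile_iter: "is_tile P T \<Longrightarrow> X \<in> iter k T \<Longrightarrow> is_tile P X"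
  by (induction k arbitrary: X) (auto simp: iter_Suc intro: is_tile_subst)

lemma finite_iter: "is_tile P T \<Longrightarrow> finite (iter k T)"
  by (induction k) (auto simp: iter_Suc intro: finite_subst_tile is_tile_iter)

lemma iter_move:
  assumes "is_tile P T"
  shows "iter k (move \<alpha> t T) = move \<alpha> (infl ^ k *\<^sub>R t) ` iter k T"
proof (induction k)
  case (Suc k)
  then show ?case
    using is_tile_iter [OF assms] by (auto simp: iter_Suc subst_move)
qed simp

lemma Union_iter:
  assumes "is_tile P T"
  shows "(\<Union>X\<in>iter k T. snd X) = (*\<^sub>R) (infl ^ k) ` snd T"
proof (induction k)
  case (Suc k)
  have "(\<Union>X\<in>iter (Suc k) T. snd X) = (\<Union>X\<in>iter k T. (*\<^sub>R) infl ` snd X)"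
    using is_tile_iter [OF assms] by (simp add: iter_Suc selfsimilar_tile)
  also have "\<dots> = (*\<^sub>R) infl ` (\<Union>X\<in>iter k T. snd X)"
    by blast
  finally show ?case
    by (simp add: Suc image_image)
qed simp

lemma snd_iter_subset:
  assumes "is_tile P T" "X \<in> iter k T"
  shows "snd X \<subseteq> (*\<^sub>R) (infl ^ k) ` snd T"
  using Union_iter [OF assms(1)] assms(2) by blast

lemma infl_power_pos: "infl ^ k > 0"
  using infl_gt_1 by simp

lemma interior_iter_subset:
  assumes "is_tile P T" "X \<in> iter k T"
  shows "interior (snd X) \<subseteq> (*\<^sub>R) (infl ^ k) ` interior (snd T)"
  using interior_mono [OF snd_iter_subset [OF assms]]
  by (simp only: interior_scaleR_image [OF less_imp_neq [OF infl_power_pos, symmetric]])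

text \<open>Scaled down by \<open>infl ^ k\<close>, the common interior point of X and Y lies in the
  interiors of both S and T.\<close>

lemma iter_eq:
  assumes C: "nonoverlapping C" "\<And>T. T \<in> C \<Longrightarrow> is_tile P T"
    and "S \<in> C" "T \<in> C" "X \<in> iter k S" "Y \<in> iter k T"
    and "x \<in> interior (snd X)" "x \<in> interior (snd Y)"
  shows "S = T"
proof -
  have "x \<in> (*\<^sub>R) (infl ^ k) ` interior (snd S)" "x \<in> (*\<^sub>R) (infl ^ k) ` interior (snd T)"
    using interior_iter_subset [OF C(2) \<open>X \<in> iter k S\<close>] interior_iter_subset [OF C(2) \<open>Y \<in> iter k T\<close>]
      assms by (meson subsetD)+
  then obtain y z where "y \<in> interior (snd S)" "z \<in> interior (snd T)"
    "x = infl ^ k *\<^sub>R y" "x = infl ^ k *\<^sub>R z"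
    by (elim imageE)
  moreover from this have "y = z"
    using infl_power_pos [of k] by (metis scaleR_cancel_left less_irrefl)
  ultimately show ?thesis
    using nonoverlapping_eq [OF C(1)] assms by blast
qed

text \<open>One substitution step (\<open>sub\<close>) preserves the property: overlapping tiles
  have the same parent by \<open>iter_eq\<close>, and within one parent the substitution does not
  overlap.\<close>

lemma nonoverlapping_UN_iter:
  assumes "nonoverlapping C" "\<And>T. T \<in> C \<Longrightarrow> is_tile P T"
  shows "nonoverlapping (\<Union>T\<in>C. iter k T)"
  using assms
proof (induction k arbitrary: C)
  case 0
  then show ?case by simp
next
  case (Suc k)
  have sub: "nonoverlapping (\<Union>T\<in>C. \<sigma> T)" if C: "nonoverlapping C" "\<And>T. T \<in> C \<Longrightarrow> is_tile P T" for C
    unfolding nonoverlapping_def disjoint_family_on_def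
  proof (intro ballI impI)
    fix X Y assume "X \<in> (\<Union>T\<in>C. \<sigma> T)" "Y \<in> (\<Union>T\<in>C. \<sigma> T)" "X \<noteq> Y"
    then obtain S T where *: "S \<in> C" "T \<in> C" "X \<in> \<sigma> S" "Y \<in> \<sigma> T"
      by blast
    show "interior (snd X) \<inter> interior (snd Y) = {}"
    proof (rule ccontr)
      assume "interior (snd X) \<inter> interior (snd Y) \<noteq> {}"
      then obtain x where x: "x \<in> interior (snd X)" "x \<in> interior (snd Y)"
        by blast
      moreover have "S = T"
        using iter_eq [OF C \<open>S \<in> C\<close> \<open>T \<in> C\<close> _ _ x, of 1] * by (simp add: iter_Suc)
      ultimately show False
        using nonoverlapping_eq [OF nonoverlapping_subst_tile] * C(2) \<open>X \<noteq> Y\<close> by blast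
    qed
  qed
  have "(\<Union>T\<in>C. iter (Suc k) T) = (\<Union>X\<in>(\<Union>T\<in>C. iter k T). \<sigma> X)"
    by (simp add: iter_Suc)
  then show ?case
    using sub [OF Suc.IH [OF Suc.prems]] Suc.prems(2) is_tile_iter by (metis UN_E)
qed

lemma nonoverlapping_iter: "is_tile P T \<Longrightarrow> nonoverlapping (iter k T)"
  using nonoverlapping_UN_iter [of "{T}" k] by (simp add: nonoverlapping_def disjoint_family_on_def)

section \<open>Topology and area of tiles\<close>

lemma snd_tile_cases:
  assumes "is_tile P T"
  obtains \<alpha> t where "snd T = (\<lambda>x. rotation \<alpha> x + t) ` P (fst T)"
proof -
  obtain \<alpha> t where "T = move \<alpha> t (prototile P (fst T))"
    using assms by (rule is_tile_cases)
  then have "snd T = snd (move \<alpha> t (prototile P (fst T)))"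
    by simp
  then show ?thesis
    using that by (simp only: snd_move prototile_def snd_conv)
qed

lemma closure_interior_tile:
  assumes "is_tile P T"
  shows "closure (interior (snd T)) = snd T"
proof -
  obtain \<alpha> t where "snd T = (\<lambda>x. rotation \<alpha> x + t) ` P (fst T)"
    using assms by (rule snd_tile_cases)
  then show ?thesis
    by (simp only: interior_motion closure_motion closure_interior_prototile)
qed

lemma compact_tile:
  assumes "is_tile P T"
  shows "compact (snd T)"
proof -
  obtain \<alpha> t where "snd T = (\<lambda>x. rotation \<alpha> x + t) ` P (fst T)"
    using assms by (rule snd_tile_cases)
  then show ?thesis
    by (simp add: compact_motion compact_prototile)
qed

text \<open>
  The boundary of a tile may have positive measure. With the area of the interior, all
  estimates below need only inequalities.
\<close>

definition area :: "'m tile \<Rightarrow> real" where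
  "area T = measure lebesgue (interior (snd T))"

lemma lmeasurable_interior_tile: "is_tile P T \<Longrightarrow> interior (snd T) \<in> lmeasurable"
  using compact_tile by (intro lmeasurable_open bounded_interior compact_imp_bounded) auto

lemma area_move:
  assumes "is_tile P T"
  shows "area (move \<alpha> t T) = area T"
  using measure_motion [OF lmeasurable_interior_tile [OF assms]]
  by (simp add: area_def snd_move interior_motion)

lemma area_tile: "is_tile P T \<Longrightarrow> area T = area (prototile P (fst T))"
  by (metis area_move is_tile_cases is_tile_prototile)

text \<open>The packing bound. Every upper bound on a number of tiles below rests on it.\<close>

lemma sum_area_le:
  assumes C: "finite C" "nonoverlapping C" "\<And>T. T \<in> C \<Longrightarrow> is_tile P T"
    and K: "K \<in> lmeasurable" "\<And>T. T \<in> C \<Longrightarrow> interior (snd T) \<subseteq> K"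
  shows "(\<Sum>T\<in>C. area T) \<le> measure lebesgue K"
proof -
  have m: "interior (snd T) \<in> lmeasurable" if "T \<in> C" for T
    using that C lmeasurable_interior_tile by blast
  have "(\<Sum>T\<in>C. area T) = measure lebesgue (\<Union>T\<in>C. interior (snd T))"
    unfolding area_def using C m
    by (intro measure_UNION' [symmetric])
      (auto simp: nonoverlapping_def disjoint_family_on_def pairwise_def disjnt_def)
  also have "\<dots> \<le> measure lebesgue K"
    using C(1) K(1) m by (intro measure_mono_fmeasurable UN_least K(2) sets.finite_UN fmeasurableD)
  finally show ?thesis .
qed

lemma sum_area_iter_le:
  assumes "is_tile P T"
  shows "(\<Sum>X\<in>iter k T. area X) \<le> (infl ^ k)\<^sup>2 * area T"
proof -
  have "(*\<^sub>R) (infl ^ k) ` interior (snd T) \<in> lmeasurable"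
    using lmeasurable_interior_tile [OF assms] by (intro measurable_linear_image linear_scaleR)
  from sum_area_le [OF finite_iter [OF assms] nonoverlapping_iter [OF assms]
      is_tile_iter [OF assms] this interior_iter_subset [OF assms]]
  show ?thesis
    by (simp only: measure_scaleR_plane area_def)
qed

end

section \<open>Primitive substitutions\<close>

text \<open>The empty set is compact and the closure of its interior, so \<open>substitution\<close>
  admits empty prototiles. Excluding them makes areas positive;
  \<open>primitive_prototile_nonempty\<close> later discharges the assumption.\<close>

locale primitive_substitution = substitution P infl \<sigma>
  for P :: "'m::finite \<Rightarrow> (real^2) set" and infl \<sigma> +
  assumes primitive: "primitive P \<sigma>"
    and prototile_nonempty: "P i \<noteq> {}"
begin

lemma interior_tile_nonempty:
  assumes "is_tile P T"
  shows "interior (snd T) \<noteq> {}"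
proof -
  obtain \<alpha> t where "snd T = (\<lambda>x. rotation \<alpha> x + t) ` P (fst T)"
    using assms by (rule snd_tile_cases)
  then have "snd T \<noteq> {}"
    by (simp add: prototile_nonempty)
  then show ?thesis
    using closure_interior_tile [OF assms] by auto
qed

lemma area_pos:
  assumes "is_tile P T"
  shows "area T > 0"
proof -
  have "\<not> negligible (interior (snd T))"
    using interior_tile_nonempty [OF assms] by (intro open_not_negligible) auto
  then show ?thesis
    using lmeasurable_interior_tile [OF assms] measure_nonneg [of lebesgue "interior (snd T)"]
    unfolding area_def negligible_iff_measure by linarith
qed

text \<open>The area depends only on the type of a tile, and there are finitely many types.\<close>

lemma area_bounds:
  obtains a b where "0 < a" "\<And>T. is_tile P T \<Longrightarrow> a \<le> area T \<and> area T \<le> b"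
proof
  let ?A = "range (\<lambda>i. area (prototile P i))"
  show "0 < Min ?A"
    by (subst Min_gr_iff) (auto simp: area_pos)
  show "Min ?A \<le> area T \<and> area T \<le> Max ?A" if "is_tile P T" for T
    using area_tile [OF that] by simp
qed

text \<open>The supertiles of distinct tiles of C share no tile: a shared tile would have an
  interior point, contrary to \<open>iter_eq\<close>.\<close>

lemma card_UN_iter:
  assumes C: "finite C" "nonoverlapping C" "\<And>T. T \<in> C \<Longrightarrow> is_tile P T"
  shows "card {X \<in> (\<Union>T\<in>C. iter k T). Q X} = (\<Sum>T\<in>C. card {X \<in> iter k T. Q X})"
proof -
  have "S = T" if "S \<in> C" "T \<in> C" "X \<in> iter k S" "X \<in> iter k T" for S T X
    using iter_eq [OF C(2,3) that] interior_tile_nonempty [OF is_tile_iter] C(3) that by blast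
  then have "card (\<Union>T\<in>C. {X \<in> iter k T. Q X}) = (\<Sum>T\<in>C. card {X \<in> iter k T. Q X})"
    using C finite_iter by (intro card_UN_disjoint) (simp, simp, blast)
  moreover have "{X \<in> (\<Union>T\<in>C. iter k T). Q X} = (\<Union>T\<in>C. {X \<in> iter k T. Q X})"
    by blast
  ultimately show ?thesis
    by simp
qed

end

section \<open>Contraction of densities\<close>

text \<open>A positive entry of a product of nonnegative matrices has an intermediate type l with
  both factors positive: the supertile of order k contains a tile of type l, and the substitution of
  that tile contains one of type i. Prototiles may still be empty here, as
  \<open>primitive_prototile_nonempty\<close> requires.\<close>

lemma matrix_power_pos_imp_iter:
  fixes P :: "'m::finite \<Rightarrow> (real^2) set"
  assumes "substitution P infl \<sigma>"
    and "(((**) (substitution_matrix P \<sigma>) ^^ k) (mat 1)) $ i $ j > 0"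
  shows "\<exists>T\<in>substitution.iter \<sigma> k (prototile P j). fst T = i"
proof -
  interpret substitution P infl \<sigma> by fact
  show ?thesis
    using assms(2)
  proof (induction k arbitrary: i)
    case 0
    then show ?case
      by (auto simp: mat_def prototile_def split: if_splits)
  next
    case (Suc k)
    let ?M = "substitution_matrix P \<sigma>" and ?N = "((**) (substitution_matrix P \<sigma>) ^^ k) (mat 1)"
    have "(\<Sum>l\<in>UNIV. ?M $ i $ l * ?N $ l $ j) > 0"
      using Suc.prems by (simp only: funpow.simps o_apply matrix_matrix_mult_def [of ?M ?N] vec_lambda_beta)
    then obtain l where "?M $ i $ l * ?N $ l $ j \<noteq> 0"
      by (rule sum.not_neutral_contains_not_neutral [OF less_imp_neq [THEN not_sym]])
    then have l: "?M $ i $ l * ?N $ l $ j > 0"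
      by simp
    then obtain T where T: "T \<in> iter k (prototile P j)" "fst T = l"
      using Suc.IH [of l] by auto
    let ?S = "{T \<in> \<sigma> (prototile P l). \<exists>\<alpha> t. T = move \<alpha> t (prototile P i)}"
    have "card ?S \<noteq> 0"
      using l by (simp add: substitution_matrix_def)
    then have "?S \<noteq> {}"
      using card.empty by metis
    then obtain X where "X \<in> ?S"
      by (rule ex_in_conv [THEN iffD2, THEN exE])
    then have X: "X \<in> \<sigma> (prototile P l)" "fst X = i"
      by (auto simp: prototile_def)
    have "is_tile P T"
      by (rule is_tile_iter [OF is_tile_prototile T(1)])
    then obtain \<alpha> t where "T = move \<alpha> t (prototile P l)"
      using T(2) is_tile_cases by metis
    then have "move \<alpha> (infl *\<^sub>R t) X \<in> \<sigma> T"
      using X(1) by (simp add: extension)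
    then show ?case
      using T(1) X(2) by (intro bexI [of _ "move \<alpha> (infl *\<^sub>R t) X"]) (simp, auto simp: iter_Suc)
  qed
qed

context primitive_substitution
begin

text \<open>The order m is the exponent from primitivity. That it is at least 1 later lets
  \<open>iter_subset_iter\<close> raise orders without bound.\<close>

lemma iter_has_type:
  obtains m where "m \<ge> 1" "\<And>T i. is_tile P T \<Longrightarrow> \<exists>X\<in>iter m T. fst X = i"
proof -
  obtain m where "m \<ge> 1" and m: "\<And>i j. (((**) (substitution_matrix P \<sigma>) ^^ m) (mat 1)) $ i $ j > 0"
    using primitive unfolding primitive_def by blast
  have "\<exists>X\<in>iter m T. fst X = i" if T: "is_tile P T" for T i
  proof -
    obtain X where X: "X \<in> iter m (prototile P (fst T))" "fst X = i"
      using matrix_power_pos_imp_iter [OF substitution_axioms m] by blast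
    obtain \<alpha> t where "T = move \<alpha> t (prototile P (fst T))"
      using T by (rule is_tile_cases)
    then have "iter m T = move \<alpha> (infl ^ m *\<^sub>R t) ` iter m (prototile P (fst T))"
      by (metis iter_move is_tile_prototile)
    then show ?thesis
      using X by auto
  qed
  with \<open>m \<ge> 1\<close> show ?thesis
    using that by blast
qed

section \<open>Counts, densities and weights in supertiles\<close>

definition copies :: "'m \<Rightarrow> real \<Rightarrow> nat \<Rightarrow> 'm tile \<Rightarrow> nat" where
  "copies i \<alpha> k T = card {X \<in> iter k T. \<exists>t. X = move \<alpha> t (prototile P i)}"

text \<open>The motion is a bijection of supertiles that carries the copies with angle \<alpha> -
  \<theta> to those with angle \<alpha>.\<close>

lemma copies_move:
  assumes "is_tile P T"
  shows "copies i \<alpha> k (move \<theta> t T) = copies i (\<alpha> - \<theta>) k T"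
proof -
  have *: "(\<exists>u. move \<theta> s X = move \<alpha> u (prototile P i)) \<longleftrightarrow>
      (\<exists>u. X = move (\<alpha> - \<theta>) u (prototile P i))" for s X
  proof
    assume "\<exists>u. move \<theta> s X = move \<alpha> u (prototile P i)"
    then obtain u where "move \<theta> s X = move \<alpha> u (prototile P i)" ..
    then have "X = move (- \<theta>) (- rotation (- \<theta>) s) (move \<alpha> u (prototile P i))"
      by (metis move_inverse(1))
    then show "\<exists>u. X = move (\<alpha> - \<theta>) u (prototile P i)"
      by (auto simp: move_move)
  qed (auto simp: move_move)
  have "{X \<in> iter k (move \<theta> t T). \<exists>u. X = move \<alpha> u (prototile P i)} =
      move \<theta> (infl ^ k *\<^sub>R t) ` {X \<in> iter k T. \<exists>u. X = move (\<alpha> - \<theta>) u (prototile P i)}"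
    unfolding iter_move [OF assms] * [symmetric, of _ "infl ^ k *\<^sub>R t"] by blast
  then show ?thesis
    by (simp only: copies_def card_image [OF inj_on_subset [OF inj_move subset_UNIV]])
qed

lemma copies_add:
  assumes "is_tile P T"
  shows "copies i \<alpha> (a + b) T = (\<Sum>X\<in>iter a T. copies i \<alpha> b X)"
  unfolding copies_def iter_add
  by (rule card_UN_iter [OF finite_iter [OF assms] nonoverlapping_iter [OF assms] is_tile_iter [OF assms]])

definition density :: "'m \<Rightarrow> real \<Rightarrow> nat \<Rightarrow> 'm tile \<Rightarrow> real" where
  "density i \<alpha> k T = copies i \<alpha> k T / ((infl ^ k)\<^sup>2 * area T)"

lemma density_move:
  assumes "is_tile P T"
  shows "density i \<alpha> k (move \<theta> t T) = density i (\<alpha> - \<theta>) k T"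
  using assms by (simp add: density_def copies_move area_move)

lemma density_nonneg: "is_tile P T \<Longrightarrow> density i \<alpha> k T \<ge> 0"
  using area_pos [of T] by (simp add: density_def)

text \<open>The counted copies all have the area of prototile i and are packed into the inflated
  tile.\<close>

lemma density_le:
  assumes T: "is_tile P T"
  shows "density i \<alpha> k T \<le> 1 / area (prototile P i)"
proof -
  let ?C = "{X \<in> iter k T. \<exists>t. X = move \<alpha> t (prototile P i)}"
  have "copies i \<alpha> k T * area (prototile P i) = (\<Sum>X\<in>?C. area X)"
  proof -
    have "area X = area (prototile P i)" if "X \<in> ?C" for X
      using that area_move [OF is_tile_prototile] by blast
    then have "(\<Sum>X\<in>?C. area X) = (\<Sum>X\<in>?C. area (prototile P i))"
      by (rule sum.cong [OF refl])
    then show ?thesis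
      by (simp only: copies_def sum_constant)
  qed
  also have "\<dots> \<le> (\<Sum>X\<in>iter k T. area X)"
    by (intro sum_mono2 finite_iter T less_imp_le [OF area_pos [OF is_tile_iter [OF T]]]) auto
  also have "\<dots> \<le> (infl ^ k)\<^sup>2 * area T"
    using T by (rule sum_area_iter_le)
  finally have "copies i \<alpha> k T * area (prototile P i) \<le> (infl ^ k)\<^sup>2 * area T" .
  moreover have "(infl ^ k)\<^sup>2 * area T > 0"
    by (intro mult_pos_pos zero_less_power infl_power_pos area_pos T)
  ultimately show ?thesis
    using area_pos [OF is_tile_prototile, of i] unfolding density_def
    by (simp only: pos_le_divide_eq times_divide_eq_left divide_le_eq_1_pos)
qed

text \<open>The share of X in the area of the inflated tile T. The shares sum to at most 1, as
  boundaries may take up area.\<close>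

definition weight :: "nat \<Rightarrow> 'm tile \<Rightarrow> 'm tile \<Rightarrow> real" where
  "weight a T X = area X / ((infl ^ a)\<^sup>2 * area T)"

lemma sum_weight_le:
  assumes "is_tile P T"
  shows "(\<Sum>X\<in>iter a T. weight a T X) \<le> 1"
proof -
  have "(infl ^ a)\<^sup>2 * area T > 0"
    by (intro mult_pos_pos zero_less_power infl_power_pos area_pos assms)
  then show ?thesis
    using sum_area_iter_le [OF assms, of a]
    unfolding weight_def sum_divide_distrib [symmetric] by (simp only: divide_le_eq_1_pos)
qed

lemma weight_nonneg: "is_tile P T \<Longrightarrow> X \<in> iter a T \<Longrightarrow> weight a T X \<ge> 0"
  using area_pos [of T] area_pos [OF is_tile_iter, of T X a] by (simp add: weight_def)

lemma density_add:
  assumes T: "is_tile P T"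
  shows "density i \<alpha> (a + b) T = (\<Sum>X\<in>iter a T. weight a T X * density i \<alpha> b X)"
proof -
  have "weight a T X * density i \<alpha> b X = copies i \<alpha> b X / ((infl ^ (a + b))\<^sup>2 * area T)"
    if "X \<in> iter a T" for X
    using area_pos [OF is_tile_iter [OF T that]]
    by (simp add: weight_def density_def power_add power_mult_distrib)
  then show ?thesis
    using T by (simp add: density_def copies_add sum_divide_distrib)
qed

section \<open>The change of density under a rotation\<close>

text \<open>This is \<open>E\<^sub>k(\<theta>)\<close>. Densities are invariant under translation,
  so the motions with translation 0 represent all of them; \<open>le_dev\<close> restores the
  general form.\<close>

definition dev :: "'m \<Rightarrow> real \<Rightarrow> real \<Rightarrow> nat \<Rightarrow> real" where
  "dev i \<alpha> \<theta> k = (SUP T\<in>{T. is_tile P T}. \<bar>density i \<alpha> k (move \<theta> 0 T) - density i \<alpha> k T\<bar>)"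

text \<open>Both densities lie between 0 and this bound. It makes the supremum in \<open>dev\<close>
  finite and does not depend on \<theta>.\<close>

lemma abs_density_diff_le:
  assumes "is_tile P T"
  shows "\<bar>density i \<alpha> k (move \<theta> t T) - density i \<alpha> k T\<bar> \<le> 1 / area (prototile P i)"
proof -
  have "is_tile P (move \<theta> t T)"
    using assms by simp
  from density_nonneg [OF this, of i \<alpha> k] density_le [OF this, of i \<alpha> k]
    density_nonneg [OF assms, of i \<alpha> k] density_le [OF assms, of i \<alpha> k]
  show ?thesis
    by linarith
qed

lemma le_dev:
  assumes "is_tile P T"
  shows "\<bar>density i \<alpha> k (move \<theta> t T) - density i \<alpha> k T\<bar> \<le> dev i \<alpha> \<theta> k"
proof -
  have "\<bar>density i \<alpha> k (move \<theta> 0 T) - density i \<alpha> k T\<bar> \<le> dev i \<alpha> \<theta> k"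
    unfolding dev_def using assms abs_density_diff_le
    by (intro cSUP_upper bdd_aboveI2 [of _ _ "1 / area (prototile P i)"]) auto
  then show ?thesis
    using assms by (simp add: density_move)
qed

lemma dev_le:
  assumes "\<And>T. is_tile P T \<Longrightarrow> \<bar>density i \<alpha> k (move \<theta> 0 T) - density i \<alpha> k T\<bar> \<le> x"
  shows "dev i \<alpha> \<theta> k \<le> x"
  unfolding dev_def
proof (rule cSUP_least)
  show "{T. is_tile P T} \<noteq> {}"
    by (metis empty_iff is_tile_prototile mem_Collect_eq)
qed (simp add: assms)

lemma dev_nonneg: "dev i \<alpha> \<theta> k \<ge> 0"
  by (rule order_trans [OF abs_ge_zero le_dev [OF is_tile_prototile]])

text \<open>The decomposition of the rotated tile is the rotated decomposition with the same
  weights, so the two averages can be subtracted term by term.\<close>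

lemma density_diff_add:
  assumes T: "is_tile P T"
  shows "density i \<alpha> (a + b) (move \<theta> 0 T) - density i \<alpha> (a + b) T =
    (\<Sum>X\<in>iter a T. weight a T X * (density i \<alpha> b (move \<theta> 0 X) - density i \<alpha> b X))"
proof -
  have "density i \<alpha> (a + b) (move \<theta> 0 T) =
      (\<Sum>X\<in>iter a T. weight a (move \<theta> 0 T) (move \<theta> 0 X) * density i \<alpha> b (move \<theta> 0 X))"
    using T by (simp add: density_add iter_move sum.reindex inj_on_subset [OF inj_move subset_UNIV])
  also have "\<dots> = (\<Sum>X\<in>iter a T. weight a T X * density i \<alpha> b (move \<theta> 0 X))"
    using T is_tile_iter [OF T] by (intro sum.cong) (simp_all add: weight_def area_move)
  finally show ?thesis
    by (simp add: density_add [OF T] sum_subtractf right_diff_distrib)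
qed

lemma dev_add_le: "dev i \<alpha> \<theta> (a + b) \<le> dev i \<alpha> \<theta> b"
proof (rule dev_le)
  fix T assume T: "is_tile P T"
  have "\<bar>density i \<alpha> (a + b) (move \<theta> 0 T) - density i \<alpha> (a + b) T\<bar>
      \<le> (\<Sum>X\<in>iter a T. weight a T X * dev i \<alpha> \<theta> b)"
    unfolding density_diff_add [OF T]
    by (intro order_trans [OF sum_abs] sum_mono)
      (simp add: abs_mult weight_nonneg T le_dev is_tile_iter [OF T] mult_left_mono)
  also have "\<dots> \<le> dev i \<alpha> \<theta> b"
    using mult_right_mono [OF sum_weight_le [OF T] dev_nonneg] by (simp add: sum_distrib_right)
  finally show "\<bar>density i \<alpha> (a + b) (move \<theta> 0 T) - density i \<alpha> (a + b) T\<bar> \<le> dev i \<alpha> \<theta> b" .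
qed

lemma decseq_dev: "decseq (dev i \<alpha> \<theta>)"
  by (rule decseq_SucI) (metis dev_add_le plus_1_eq_Suc)

section \<open>Recurrent angles and the contraction\<close>

text \<open>The order N is the same for all T, which gives one contraction constant for all tiles.
  The translation may depend on T.\<close>

definition recurrent_angle :: "real \<Rightarrow> bool" where
  "recurrent_angle \<theta> \<longleftrightarrow>
     (\<exists>N. \<forall>T. is_tile P T \<longrightarrow> (\<exists>W\<in>iter N T. \<exists>t. move \<theta> t W \<in> iter N T))"

text \<open>Let V be W turned through \<theta>. The supertile of W contains some X and X turned
  through \<theta>; turning the latter once more gives a tile in the supertile of V.\<close>

lemma recurrent_angle_double:
  assumes "recurrent_angle \<theta>"
  shows "recurrent_angle (2 * \<theta>)"
proof -
  obtain N where N: "\<And>T. is_tile P T \<Longrightarrow> \<exists>W\<in>iter N T. \<exists>t. move \<theta> t W \<in> iter N T"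
    using assms unfolding recurrent_angle_def by blast
  have "\<exists>X\<in>iter (N + N) T. \<exists>t. move (2 * \<theta>) t X \<in> iter (N + N) T" if T: "is_tile P T" for T
  proof -
    obtain W t where W: "W \<in> iter N T" "move \<theta> t W \<in> iter N T"
      using N [OF T] by blast
    have "is_tile P W"
      using is_tile_iter [OF T W(1)] .
    then obtain X s where X: "X \<in> iter N W" "move \<theta> s X \<in> iter N W"
      using N by blast
    have "move \<theta> (infl ^ N *\<^sub>R t) (move \<theta> s X) \<in> iter N (move \<theta> t W)"
      using X(2) by (simp add: iter_move \<open>is_tile P W\<close>)
    then have "\<exists>t. move (2 * \<theta>) t X \<in> iter (N + N) T"
      using W(2) by (auto simp: iter_add move_move)
    then show ?thesis
      using W(1) X(1) by (auto simp: iter_add)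
  qed
  then show ?thesis
    unfolding recurrent_angle_def by blast
qed

text \<open>One pair in one supertile suffices: by primitivity every supertile of order m contains a
  tile of type j, whose supertile of order n contains a moved copy of the pair.\<close>

lemma recurrent_angleI:
  assumes "Y \<in> iter n (prototile P j)" "move \<theta> t Y \<in> iter n (prototile P j)"
  shows "recurrent_angle \<theta>"
proof -
  obtain m where m: "\<And>T i. is_tile P T \<Longrightarrow> \<exists>X\<in>iter m T. fst X = i"
    using iter_has_type by metis
  have "\<exists>W\<in>iter (m + n) T. \<exists>t. move \<theta> t W \<in> iter (m + n) T" if T: "is_tile P T" for T
  proof -
    obtain X where X: "X \<in> iter m T" "fst X = j"
      using m [OF T] by blast
    obtain \<beta> s where "X = move \<beta> s (prototile P j)"
      using is_tile_cases [OF is_tile_iter [OF T X(1)]] X(2) by metis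
    then have iX: "iter n X = move \<beta> (infl ^ n *\<^sub>R s) ` iter n (prototile P j)"
      by (simp add: iter_move)
    let ?s = "infl ^ n *\<^sub>R s"
    \<comment> \<open>Plane rotations commute, so conjugation by a motion keeps the angle \<theta>
      and changes only the translation.\<close>
    have "move \<beta> ?s (move \<theta> t Y) = move \<theta> (rotation \<beta> t + ?s - rotation \<theta> ?s) (move \<beta> ?s Y)"
      by (simp add: move_move add.commute)
    then have "move \<theta> (rotation \<beta> t + ?s - rotation \<theta> ?s) (move \<beta> ?s Y) \<in> iter n X"
      using assms(2) by (metis iX imageI)
    moreover have "move \<beta> ?s Y \<in> iter n X"
      using assms(1) by (simp add: iX)
    ultimately show ?thesis
      using X(1) by (auto simp: iter_add)
  qed
  then show ?thesis
    unfolding recurrent_angle_def by blast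
qed

lemma dev_contraction:
  assumes "recurrent_angle \<theta>"
  obtains N \<epsilon> where "0 < \<epsilon>" "\<epsilon> \<le> 1/2"
    "\<And>k. dev i \<alpha> \<theta> (N + k) \<le> \<epsilon> * dev i \<alpha> (2 * \<theta>) k + (1 - 2 * \<epsilon>) * dev i \<alpha> \<theta> k"
proof -
  obtain N where N: "\<And>T. is_tile P T \<Longrightarrow> \<exists>W\<in>iter N T. \<exists>t. move \<theta> t W \<in> iter N T"
    using assms unfolding recurrent_angle_def by blast
  obtain a b where a: "0 < a" and ab: "\<And>T. is_tile P T \<Longrightarrow> a \<le> area T \<and> area T \<le> b"
    using area_bounds by metis
  \<comment> \<open>Half of a lower bound for the weights of tiles in supertiles of order N.\<close>
  define \<epsilon> where "\<epsilon> = a / (2 * ((infl ^ N)\<^sup>2 * b))"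
  have "a \<le> b"
    using ab [OF is_tile_prototile] by fastforce
  have "1 \<le> (infl ^ N)\<^sup>2"
    using infl_gt_1 by (intro one_le_power) auto
  have pos: "(infl ^ N)\<^sup>2 * b > 0"
    using a \<open>a \<le> b\<close> by (intro mult_pos_pos zero_less_power infl_power_pos) simp
  have weight_ge: "2 * \<epsilon> \<le> weight N T X" if T: "is_tile P T" and X: "X \<in> iter N T" for T X
  proof -
    have "a / ((infl ^ N)\<^sup>2 * b) \<le> area X / ((infl ^ N)\<^sup>2 * area T)"
      using ab [OF T] ab [OF is_tile_iter [OF T X]] a
      by (intro frac_le mult_pos_pos zero_less_power infl_power_pos mult_left_mono area_pos [OF T]) auto
    then show ?thesis
      by (simp add: \<epsilon>_def weight_def)
  qed
  show ?thesis
  proof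
    show "0 < \<epsilon>"
      unfolding \<epsilon>_def using a pos by simp
    have "1 * a \<le> (infl ^ N)\<^sup>2 * b"
      using \<open>a \<le> b\<close> \<open>1 \<le> (infl ^ N)\<^sup>2\<close> a by (intro mult_mono) auto
    then show "\<epsilon> \<le> 1/2"
      unfolding \<epsilon>_def using pos by (simp add: divide_simps)
    fix k
    show "dev i \<alpha> \<theta> (N + k) \<le> \<epsilon> * dev i \<alpha> (2 * \<theta>) k + (1 - 2 * \<epsilon>) * dev i \<alpha> \<theta> k"
    proof (rule dev_le)
      fix T assume T: "is_tile P T"
      define \<psi> where "\<psi> X = density i \<alpha> k (move \<theta> 0 X) - density i \<alpha> k X" for X
      have \<psi>: "\<bar>\<psi> X\<bar> \<le> dev i \<alpha> \<theta> k" if "X \<in> iter N T" for X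
        unfolding \<psi>_def using le_dev is_tile_iter [OF T that] by blast
      obtain W t where W: "W \<in> iter N T" "move \<theta> t W \<in> iter N T"
        using N [OF T] by blast
      define V where "V = move \<theta> t W"
      have tW: "is_tile P W"
        using is_tile_iter [OF T W(1)] .
      \<comment> \<open>The weight taken out at \<open>W\<close> and \<open>V\<close>; it also fits if \<open>W = V\<close>.\<close>
      define e where "e X = \<epsilon> * (of_bool (X = W) + of_bool (X = V))" for X
      have e_le: "e X \<le> weight N T X" if "X \<in> iter N T" for X
        using weight_ge [OF T that] \<open>0 < \<epsilon>\<close> by (auto simp: e_def)
      have sum_e: "(\<Sum>X\<in>iter N T. e X * f X) = \<epsilon> * (f W + f V)" for f :: "'m tile \<Rightarrow> real"
      proof -
        have "(\<Sum>X\<in>iter N T. e X * f X) =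
            (\<Sum>X\<in>iter N T. (if X = W then \<epsilon> * f X else 0) + (if X = V then \<epsilon> * f X else 0))"
          by (intro sum.cong) (auto simp: e_def algebra_simps)
        also have "\<dots> = \<epsilon> * (f W + f V)"
          using finite_iter [OF T] W by (simp add: sum.distrib sum.delta V_def algebra_simps)
        finally show ?thesis .
      qed
      \<comment> \<open>The density of V cancels: up to translation, V is W turned through \<theta>,
        and V turned through \<theta> is W turned through 2 * \<theta>.\<close>
      have "\<psi> W + \<psi> V = density i \<alpha> k (move (2 * \<theta>) 0 W) - density i \<alpha> k W"
        by (simp add: \<psi>_def V_def density_move tW algebra_simps)
      then have 1: "\<bar>\<psi> W + \<psi> V\<bar> \<le> dev i \<alpha> (2 * \<theta>) k"
        using le_dev [OF tW] by simp
      have "\<bar>\<Sum>X\<in>iter N T. (weight N T X - e X) * \<psi> X\<bar>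
          \<le> (\<Sum>X\<in>iter N T. (weight N T X - e X) * dev i \<alpha> \<theta> k)"
        using e_le by (intro order_trans [OF sum_abs] sum_mono) (simp add: abs_mult \<psi> mult_left_mono)
      also have "\<dots> = ((\<Sum>X\<in>iter N T. weight N T X) - 2 * \<epsilon>) * dev i \<alpha> \<theta> k"
        using sum_e [of "\<lambda>_. 1"] by (simp add: sum_distrib_right [symmetric] sum_subtractf)
      also have "\<dots> \<le> (1 - 2 * \<epsilon>) * dev i \<alpha> \<theta> k"
        using sum_weight_le [OF T] by (intro mult_right_mono dev_nonneg) simp
      finally have 2: "\<bar>\<Sum>X\<in>iter N T. (weight N T X - e X) * \<psi> X\<bar> \<le> (1 - 2 * \<epsilon>) * dev i \<alpha> \<theta> k" .
      have "density i \<alpha> (N + k) (move \<theta> 0 T) - density i \<alpha> (N + k) T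
          = \<epsilon> * (\<psi> W + \<psi> V) + (\<Sum>X\<in>iter N T. (weight N T X - e X) * \<psi> X)"
        unfolding density_diff_add [OF T] \<psi>_def [symmetric] sum_e [of \<psi>, symmetric]
        by (simp add: sum.distrib [symmetric] algebra_simps)
      also have "\<bar>\<dots>\<bar> \<le> \<bar>\<epsilon> * (\<psi> W + \<psi> V)\<bar> + \<bar>\<Sum>X\<in>iter N T. (weight N T X - e X) * \<psi> X\<bar>"
        by (rule abs_triangle_ineq)
      also have "\<dots> \<le> \<epsilon> * dev i \<alpha> (2 * \<theta>) k + (1 - 2 * \<epsilon>) * dev i \<alpha> \<theta> k"
        using 1 2 \<open>0 < \<epsilon>\<close> by (intro add_mono) (simp_all add: abs_mult)
      finally show "\<bar>density i \<alpha> (N + k) (move \<theta> 0 T) - density i \<alpha> (N + k) T\<bar>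
          \<le> \<epsilon> * dev i \<alpha> (2 * \<theta>) k + (1 - 2 * \<epsilon>) * dev i \<alpha> \<theta> k" .
    qed
  qed
qed

lemma dev_converges: obtains L where "dev i \<alpha> \<theta> \<longlonglongrightarrow> L"
  using decseq_convergent [OF decseq_dev, of 0] dev_nonneg by metis

text \<open>Each induction step passes from \<theta> to 2 * \<theta> and gains a factor 1/2, hence
  \<theta> and L are arbitrary. The base case is a bound uniform in the angle.\<close>

lemma dev_tendsto_le:
  assumes "recurrent_angle \<theta>" "dev i \<alpha> \<theta> \<longlonglongrightarrow> L"
  shows "L \<le> 1 / area (prototile P i) / 2 ^ n"
  using assms
proof (induction n arbitrary: \<theta> L)
  case 0
  have "dev i \<alpha> \<theta> k \<le> 1 / area (prototile P i)" for k
    using abs_density_diff_le by (rule dev_le)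
  then show ?case
    using LIMSEQ_le_const2 [OF 0(2)] by auto
next
  case (Suc n)
  obtain M where M: "dev i \<alpha> (2 * \<theta>) \<longlonglongrightarrow> M"
    by (rule dev_converges)
  obtain N \<epsilon> where "0 < \<epsilon>" and le:
    "\<And>k. dev i \<alpha> \<theta> (N + k) \<le> \<epsilon> * dev i \<alpha> (2 * \<theta>) k + (1 - 2 * \<epsilon>) * dev i \<alpha> \<theta> k"
    using dev_contraction [OF Suc.prems(1), of i \<alpha>] by blast
  have "(\<lambda>k. dev i \<alpha> \<theta> (N + k)) \<longlonglongrightarrow> L"
    using LIMSEQ_ignore_initial_segment [OF Suc.prems(2), of N] by (simp add: add.commute)
  moreover have "(\<lambda>k. \<epsilon> * dev i \<alpha> (2 * \<theta>) k + (1 - 2 * \<epsilon>) * dev i \<alpha> \<theta> k)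
      \<longlonglongrightarrow> \<epsilon> * M + (1 - 2 * \<epsilon>) * L"
    by (intro tendsto_intros M Suc.prems(2))
  ultimately have "L \<le> \<epsilon> * M + (1 - 2 * \<epsilon>) * L"
    using le by (intro LIMSEQ_le) auto
  then have "\<epsilon> * (2 * L) \<le> \<epsilon> * M"
    by (simp add: algebra_simps)
  then have "2 * L \<le> M"
    using \<open>0 < \<epsilon>\<close> by simp
  moreover have "M \<le> 1 / area (prototile P i) / 2 ^ n"
    using Suc.IH [OF recurrent_angle_double [OF Suc.prems(1)] M] .
  ultimately show ?case
    by (simp add: field_simps)
qed

lemma dev_tendsto_0:
  assumes "recurrent_angle \<theta>"
  shows "dev i \<alpha> \<theta> \<longlonglongrightarrow> 0"
proof -
  obtain L where L: "dev i \<alpha> \<theta> \<longlonglongrightarrow> L"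
    by (rule dev_converges)
  have "(\<lambda>n. 1 / area (prototile P i) / 2 ^ n) \<longlonglongrightarrow> 0"
    using tendsto_mult_right_zero [OF LIMSEQ_inverse_realpow_zero [of 2]]
    by (simp add: divide_inverse)
  then have "L \<le> 0"
    using dev_tendsto_le [OF assms L] LIMSEQ_le_const by blast
  moreover have "L \<ge> 0"
    using LIMSEQ_le_const [OF L] dev_nonneg by blast
  ultimately show ?thesis
    using L by simp
qed

end

section \<open>Frequencies in large balls\<close>

lemma measure_cball_plane:
  assumes "r \<ge> 0"
  shows "measure lebesgue (cball (x::real^2) r) = pi * r\<^sup>2"
  using content_cball [OF assms, of x] by (simp add: unit_ball_vol_2)

lemma norm_le_norm_add_dist:
  fixes x y :: "'a::real_normed_vector"
  shows "norm y \<le> norm x + dist x y"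
  using norm_triangle_sub [of y x] by (simp add: dist_norm norm_minus_commute)

lemma substitution_tilings_supertile:
  assumes "\<T> \<in> substitution_tilings P \<sigma>" "finite F" "F \<subseteq> \<T>"
  obtains i k \<alpha> t where "move \<alpha> t ` F \<subseteq> supertile P \<sigma> k i"
proof -
  have "\<exists>i k \<alpha> t. move \<alpha> t ` F \<subseteq> supertile P \<sigma> k i"
    using assms by (simp add: substitution_tilings_def)
  then show ?thesis
    using that by (elim exE)
qed

context primitive_substitution
begin

lemma tile_diameter:
  obtains d where "d > 0" "\<And>T x y. is_tile P T \<Longrightarrow> x \<in> snd T \<Longrightarrow> y \<in> snd T \<Longrightarrow> dist x y \<le> d"
proof
  \<comment> \<open>The summand 1 makes the bound positive from \<open>diameter_ge_0\<close>
    alone.\<close>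
  let ?d = "Max (range (\<lambda>i. diameter (P i))) + 1"
  have le: "diameter (P i) < ?d" for i
  proof -
    have "diameter (P i) \<le> Max (range (\<lambda>i. diameter (P i)))"
      by (rule Max_ge) auto
    then show ?thesis
      by linarith
  qed
  show "?d > 0"
    using le diameter_ge_0 [OF compact_imp_bounded [OF compact_prototile]] by (rule le_less_trans [rotated])
  fix T x y assume T: "is_tile P T" and xy: "x \<in> snd T" "y \<in> snd T"
  obtain \<alpha> t where "snd T = (\<lambda>x. rotation \<alpha> x + t) ` P (fst T)"
    using T by (rule snd_tile_cases)
  with xy obtain u v where "u \<in> P (fst T)" "v \<in> P (fst T)" "x = rotation \<alpha> u + t" "y = rotation \<alpha> v + t"
    by blast
  then have "dist x y \<le> diameter (P (fst T))"
    using diameter_bounded_bound [OF compact_imp_bounded [OF compact_prototile]] by (simp only: dist_rotation)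
  with le show "dist x y \<le> ?d"
    by (meson less_imp_le order_trans)
qed

section \<open>Finite patches as parts of supertiles\<close>

text \<open>Packing bounds the size of every finite subset by the same number, which forces C itself
  to be finite.\<close>

lemma finite_tiles_bounded:
  assumes C: "nonoverlapping C" "\<And>T. T \<in> C \<Longrightarrow> is_tile P T" "\<And>T. T \<in> C \<Longrightarrow> snd T \<subseteq> cball 0 r"
  shows "finite C"
proof -
  obtain a b where a: "0 < a" and ab: "\<And>T. is_tile P T \<Longrightarrow> a \<le> area T \<and> area T \<le> b"
    using area_bounds by metis
  let ?m = "measure lebesgue (cball (0::real^2) r)"
  have "card F \<le> nat \<lfloor>?m / a\<rfloor>" if F: "F \<subseteq> C" "finite F" for F
  proof -
    have "interior (snd T) \<subseteq> cball 0 r" if "T \<in> F" for T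
      using C(3) that F(1) interior_subset by (meson subsetD order_trans)
    moreover have "is_tile P T" if "T \<in> F" for T
      using C(2) F(1) that by (meson subsetD)
    moreover from this have "(\<Sum>T\<in>F. a) \<le> (\<Sum>T\<in>F. area T)"
      using ab by (intro sum_mono) simp
    ultimately have "card F * a \<le> ?m"
      using sum_area_le [OF F(2) nonoverlapping_subset [OF C(1) F(1)], of "cball 0 r"]
      by (simp add: lmeasurable_cball)
    then show ?thesis
      using a by (simp add: le_nat_floor pos_le_divide_eq)
  qed
  then show ?thesis
    by (meson finite_if_finite_subsets_card_bdd)
qed

text \<open>The way up the hierarchy: by primitivity the supertile of a prototile contains a tile of
  the type of U, and a motion of the whole supertile takes that tile to U.\<close>

lemma tile_in_iter:
  obtains m where "m \<ge> 1" "\<And>U. is_tile P U \<Longrightarrow> \<exists>V. is_tile P V \<and> U \<in> iter m V"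
proof -
  obtain m where "m \<ge> 1" and m: "\<And>T i. is_tile P T \<Longrightarrow> \<exists>X\<in>iter m T. fst X = i"
    using iter_has_type by metis
  have "\<exists>V. is_tile P V \<and> U \<in> iter m V" if U: "is_tile P U" for U
  proof -
    fix j
    obtain X where X: "X \<in> iter m (prototile P j)" "fst X = fst U"
      using m [OF is_tile_prototile] by blast
    obtain \<alpha> s where "X = move \<alpha> s (prototile P (fst U))"
      using is_tile_cases [OF is_tile_iter [OF is_tile_prototile X(1)]] X(2) by metis
    then have pU: "prototile P (fst U) = move (- \<alpha>) (- rotation (- \<alpha>) s) X"
      by (simp add: move_inverse(1))
    obtain \<beta> t where "U = move \<beta> t (prototile P (fst U))"
      using U by (rule is_tile_cases)
    then have "U = move \<beta> t (move (- \<alpha>) (- rotation (- \<alpha>) s) X)"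
      using pU by simp
    then obtain \<gamma> u where UX: "U = move \<gamma> u X"
      unfolding move_move by blast
    \<comment> \<open>The translation is scaled down because \<open>iter m\<close> multiplies it by
      \<open>infl ^ m\<close>.\<close>
    let ?V = "move \<gamma> ((1 / infl ^ m) *\<^sub>R u) (prototile P j)"
    have "iter m ?V = move \<gamma> u ` iter m (prototile P j)"
      using infl_gt_1 by (simp add: iter_move)
    then have "U \<in> iter m ?V"
      using UX X(1) by (metis imageI)
    then show ?thesis
      using is_tile_move is_tile_prototile by metis
  qed
  then show ?thesis
    using that \<open>m \<ge> 1\<close> by blast
qed

text \<open>A patch may be found in a supertile of order below k. Enclosing that supertile in one of
  order at least k allows it to be cut into supertiles of order k.\<close>

lemma iter_subset_iter:
  assumes "is_tile P U"
  shows "\<exists>V n'. is_tile P V \<and> k \<le> n' \<and> iter n U \<subseteq> iter n' V"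
proof (induction k)
  case 0
  then show ?case
    using assms by blast
next
  case (Suc k)
  obtain V n' where V: "is_tile P V" "k \<le> n'" "iter n U \<subseteq> iter n' V"
    using Suc by blast
  obtain m where "m \<ge> 1" "\<And>U. is_tile P U \<Longrightarrow> \<exists>V. is_tile P V \<and> U \<in> iter m V"
    using tile_in_iter by metis
  then obtain W where W: "is_tile P W" "V \<in> iter m W"
    using V(1) by blast
  have "iter n' V \<subseteq> iter (m + n') W"
    using W(2) unfolding iter_add by (rule UN_upper)
  then have "iter n U \<subseteq> iter (m + n') W"
    using V(3) by (rule order_trans [rotated])
  moreover have "Suc k \<le> m + n'"
    using V(2) \<open>m \<ge> 1\<close> by simp
  ultimately show ?case
    using W(1) by blast
qed

text \<open>Instead of moving F into a supertile, the supertile is moved back onto F; it is then the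
  supertile of a moved prototile.\<close>

lemma substitution_tiling_patch:
  assumes \<T>: "\<T> \<in> substitution_tilings P \<sigma>" and F: "finite F" "F \<subseteq> \<T>"
  obtains n U where "is_tile P U" "F \<subseteq> iter n U"
proof -
  obtain i n \<alpha> t where "move \<alpha> t ` F \<subseteq> supertile P \<sigma> n i"
    using assms by (rule substitution_tilings_supertile)
  then have sub: "move \<alpha> t ` F \<subseteq> iter n (prototile P i)"
    by (simp add: supertile_def iter_def)
  let ?s = "- rotation (- \<alpha>) t"
  let ?U = "move (- \<alpha>) ((1 / infl ^ n) *\<^sub>R ?s) (prototile P i)"
  have U: "iter n ?U = move (- \<alpha>) ?s ` iter n (prototile P i)"
    using infl_gt_1 by (simp add: iter_move)
  have "F \<subseteq> iter n ?U"
  proof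
    fix T assume "T \<in> F"
    then have "move (- \<alpha>) ?s (move \<alpha> t T) \<in> iter n ?U"
      unfolding U using sub by blast
    then show "T \<in> iter n ?U"
      by (simp only: move_inverse(1))
  qed
  then show ?thesis
    using that is_tile_move is_tile_prototile by metis
qed

text \<open>The enclosing supertile of order n' is cut at order k: the tiles of
  \<open>iter (n' - k) V\<close> form C.\<close>

lemma substitution_tiling_cover:
  assumes \<T>: "\<T> \<in> substitution_tilings P \<sigma>" and F: "finite F" "F \<subseteq> \<T>"
  obtains C where "finite C" "nonoverlapping C" "\<And>U. U \<in> C \<Longrightarrow> is_tile P U" "F \<subseteq> (\<Union>U\<in>C. iter k U)"
proof -
  obtain n U where U: "is_tile P U" "F \<subseteq> iter n U"
    using substitution_tiling_patch [OF assms] by metis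
  obtain V n' where V: "is_tile P V" "k \<le> n'" "iter n U \<subseteq> iter n' V"
    using iter_subset_iter [OF U(1)] by metis
  have "iter n' V = (\<Union>X\<in>iter (n' - k) V. iter k X)"
    using iter_add [of "n' - k" k V] V(2) by simp
  then have "F \<subseteq> (\<Union>X\<in>iter (n' - k) V. iter k X)"
    using U(2) V(3) by simp
  then show ?thesis
    using that finite_iter [OF V(1)] nonoverlapping_iter [OF V(1)] is_tile_iter [OF V(1)] by metis
qed

section \<open>Counting tiles in balls\<close>

text \<open>The tiles in the ball are split into the set I of those in order k supertiles inside the
  ball, where \<delta> controls the difference in proportion to area, and the rest, which lie in an
  annulus of width D, a bound on the diameter of these supertiles.\<close>

lemma copies_in_ball_diff:
  fixes D a :: real
  assumes \<T>: "\<T> \<in> substitution_tilings P \<sigma>"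
    and d: "\<And>T x y. is_tile P T \<Longrightarrow> x \<in> snd T \<Longrightarrow> y \<in> snd T \<Longrightarrow> dist x y \<le> d"
    and a: "0 < a" "\<And>T. is_tile P T \<Longrightarrow> a \<le> area T"
    and \<delta>: "\<And>U. is_tile P U \<Longrightarrow>
      \<bar>real (copies i \<alpha> k U) - real (copies i \<beta> k U)\<bar> \<le> \<delta> * ((infl ^ k)\<^sup>2 * area U)"
    and D: "D = infl ^ k * d" "0 \<le> D" "D \<le> r" and "0 \<le> \<delta>"
  shows "\<bar>real (card {T \<in> tiles_in_ball \<T> r. \<exists>t. T = move \<alpha> t (prototile P i)})
      - real (card {T \<in> tiles_in_ball \<T> r. \<exists>t. T = move \<beta> t (prototile P i)})\<bar>
      \<le> \<delta> * (pi * r\<^sup>2) + 2 * pi * D / a * r"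
proof -
  have "0 \<le> r"
    using D by simp
  define Q where "Q \<gamma> X \<longleftrightarrow> (\<exists>t. X = move \<gamma> t (prototile P i))" for \<gamma> X
  have tiling: "\<And>T. T \<in> \<T> \<Longrightarrow> is_tile P T" "(\<Union>T\<in>\<T>. snd T) = UNIV" "nonoverlapping \<T>"
    using \<T> unfolding substitution_tilings_def is_tiling_def by blast+
  \<comment> \<open>All tiles that meet the ball, so that F covers the ball.\<close>
  define F where "F = {T \<in> \<T>. snd T \<inter> cball 0 r \<noteq> {}}"
  have "F \<subseteq> \<T>"
    by (auto simp: F_def)
  have "finite F"
  proof (rule finite_tiles_bounded)
    show "nonoverlapping F"
      using tiling(3) \<open>F \<subseteq> \<T>\<close> by (rule nonoverlapping_subset)
    show tF: "is_tile P T" if "T \<in> F" for T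
      using that tiling(1) by (simp add: F_def)
    show "snd T \<subseteq> cball 0 (r + d)" if "T \<in> F" for T
    proof
      fix y assume y: "y \<in> snd T"
      have "snd T \<inter> cball 0 r \<noteq> {}"
        using that by (simp add: F_def)
      then obtain x where x: "x \<in> snd T" "norm x \<le> r"
        by (metis IntE ex_in_conv mem_cball_0)
      have "norm y \<le> norm x + dist x y"
        by (rule norm_le_norm_add_dist)
      then show "y \<in> cball 0 (r + d)"
        using d [OF tF [OF that] x(1) y] x(2) by simp
    qed
  qed
  then obtain C where C: "finite C" "nonoverlapping C" "\<And>U. U \<in> C \<Longrightarrow> is_tile P U"
    and FC: "F \<subseteq> (\<Union>U\<in>C. iter k U)"
    using substitution_tiling_cover [OF \<T> _ \<open>F \<subseteq> \<T>\<close>] by metis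
  define V where "V = (\<Union>U\<in>C. iter k U)"
  have V: "nonoverlapping V"
    unfolding V_def using C(2,3) by (rule nonoverlapping_UN_iter)
  have tV: "is_tile P X" if "X \<in> V" for X
    using that C(3) is_tile_iter unfolding V_def by blast
  define C' where "C' = {U \<in> C. (*\<^sub>R) (infl ^ k) ` snd U \<subseteq> cball 0 r}"
  have C': "finite C'" "nonoverlapping C'" "\<And>U. U \<in> C' \<Longrightarrow> is_tile P U"
    using C nonoverlapping_subset [OF C(2), of C'] by (auto simp: C'_def)
  define I where "I = (\<Union>U\<in>C'. iter k U)"
  define B where "B = tiles_in_ball \<T> r"
  have tB: "is_tile P X" if "X \<in> B" for X
    using that tiling(1) by (simp add: B_def tiles_in_ball_def)
  have BF: "X \<in> F" if "X \<in> B" for X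
  proof -
    have "snd X \<noteq> {}"
      using interior_tile_nonempty [OF tB [OF that]] interior_subset by (metis subset_empty)
    then show ?thesis
      using that by (simp add: B_def F_def tiles_in_ball_def Int_absorb2)
  qed
  have "finite B"
    using \<open>finite F\<close> BF by (meson finite_subset subsetI)

  \<comment> \<open>Supertiles from the cover may contain tiles outside \<T>, but not inside the
    ball: an interior point of X lies in some T of F, so T belongs to V and, as the closure of its
    interior, overlaps X. Tiles of V that overlap are equal.\<close>
  have "I \<subseteq> B"
  proof
    fix X assume "X \<in> I"
    then obtain U where U: "U \<in> C" "(*\<^sub>R) (infl ^ k) ` snd U \<subseteq> cball 0 r" "X \<in> iter k U"
      unfolding I_def C'_def by blast
    have XV: "X \<in> V"
      using U unfolding V_def by blast
    have X: "snd X \<subseteq> cball 0 r"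
      using snd_iter_subset [OF C(3) [OF U(1)] U(3)] U(2) by (rule order_trans)
    obtain x where x: "x \<in> interior (snd X)"
      using interior_tile_nonempty [OF tV [OF XV]] by blast
    obtain T where T: "T \<in> \<T>" "x \<in> snd T"
      using tiling(2) by blast
    have "x \<in> cball 0 r"
      using x X interior_subset by (meson subsetD)
    then have "T \<in> V"
      using T FC unfolding F_def V_def by blast
    have "x \<in> closure (interior (snd T))"
      using closure_interior_tile [OF tiling(1) [OF T(1)]] T(2) by simp
    then have "interior (snd X) \<inter> interior (snd T) \<noteq> {}"
      using x open_Int_closure_eq_empty [OF open_interior, of "snd X" "interior (snd T)"] by blast
    then have "X = T"
      using nonoverlapping_eq [OF V XV \<open>T \<in> V\<close>] by blast
    then show "X \<in> B"
      using T(1) X by (simp add: B_def tiles_in_ball_def)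
  qed

  \<comment> \<open>The supertile of X has a point of norm above r and diameter at most D, so no
    point of X has norm below r - D.\<close>
  have "snd X \<subseteq> cball 0 r - ball 0 (r - D)" if X: "X \<in> B - I" for X
  proof -
    obtain U where U: "U \<in> C" "X \<in> iter k U"
      using FC BF X by blast
    then have "\<not> (*\<^sub>R) (infl ^ k) ` snd U \<subseteq> cball 0 r"
      using X unfolding I_def C'_def by blast
    then obtain v where v: "v \<in> snd U" "infl ^ k *\<^sub>R v \<notin> cball 0 r"
      by blast
    have "x \<in> cball 0 r - ball 0 (r - D)" if x: "x \<in> snd X" for x
    proof -
      obtain u where u: "u \<in> snd U" "x = infl ^ k *\<^sub>R u"
        using snd_iter_subset [OF C(3) [OF U(1)] U(2)] x by blast
      have "dist u v \<le> d"
        using d [OF C(3) [OF U(1)] u(1) v(1)] .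
      then have "dist x (infl ^ k *\<^sub>R v) \<le> D"
        using infl_power_pos [of k]
        unfolding D(1) u(2) dist_norm scaleR_right_diff_distrib [symmetric] norm_scaleR
        by (simp add: mult_left_mono)
      moreover have "norm (infl ^ k *\<^sub>R v) > r"
        using v(2) by simp
      moreover have "norm (infl ^ k *\<^sub>R v) \<le> norm x + dist x (infl ^ k *\<^sub>R v)"
        by (rule norm_le_norm_add_dist)
      moreover have "x \<in> cball 0 r"
        using X x by (auto simp: B_def tiles_in_ball_def)
      ultimately show ?thesis
        by simp
    qed
    then show ?thesis
      by blast
  qed
  then have annulus: "interior (snd X) \<subseteq> cball 0 r - ball 0 (r - D)" if "X \<in> B - I" for X
    using that interior_subset by (meson order_trans)
  have card_annulus: "card (B - I) \<le> 2 * pi * D / a * r"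
  proof -
    have "B - I \<subseteq> \<T>"
      by (auto simp: B_def tiles_in_ball_def)
    have "card (B - I) * a = (\<Sum>X\<in>B - I. a)"
      by simp
    also have "\<dots> \<le> (\<Sum>X\<in>B - I. area X)"
      using a(2) tB by (intro sum_mono) blast
    also have "\<dots> \<le> measure lebesgue (cball 0 r - ball (0::real^2) (r - D))"
      using \<open>finite B\<close> tB annulus nonoverlapping_subset [OF tiling(3) \<open>B - I \<subseteq> \<T>\<close>]
      by (intro sum_area_le fmeasurable.Diff lmeasurable_cball lmeasurable_ball) blast+
    also have "\<dots> = measure lebesgue (cball (0::real^2) r) - measure lebesgue (ball (0::real^2) (r - D))"
      using D(2) by (intro measurable_measure_Diff) (auto simp: fmeasurableD)
    also have "\<dots> = pi * r\<^sup>2 - pi * (r - D)\<^sup>2"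
      using D \<open>0 \<le> r\<close> measure_cball_plane [of r 0] measure_cball_plane [of "r - D" 0]
      by (simp add: content_cball_conv_ball)
    also have "\<dots> = 2 * pi * D * r - pi * D\<^sup>2"
      by (simp add: power2_eq_square algebra_simps)
    also have "\<dots> \<le> 2 * pi * D * r"
      by simp
    finally show ?thesis
      using a(1) by (simp add: pos_le_divide_eq)
  qed

  have split: "card {T \<in> B. Q \<gamma> T} = (\<Sum>U\<in>C'. copies i \<gamma> k U) + card {T \<in> B - I. Q \<gamma> T}" for \<gamma>
  proof -
    have "{T \<in> B. Q \<gamma> T} = {T \<in> I. Q \<gamma> T} \<union> {T \<in> B - I. Q \<gamma> T}"
      using \<open>I \<subseteq> B\<close> by blast
    moreover have "card \<dots> = card {T \<in> I. Q \<gamma> T} + card {T \<in> B - I. Q \<gamma> T}"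
      using \<open>finite B\<close> finite_subset [OF \<open>I \<subseteq> B\<close>] by (intro card_Un_disjoint) auto
    moreover have "card {T \<in> I. Q \<gamma> T} = (\<Sum>U\<in>C'. copies i \<gamma> k U)"
      unfolding I_def copies_def Q_def using C' by (rule card_UN_iter)
    ultimately show ?thesis
      by simp
  qed
  have rest: "card {T \<in> B - I. Q \<gamma> T} \<le> card (B - I)" for \<gamma>
    using \<open>finite B\<close> by (intro card_mono) auto

  have "\<bar>(\<Sum>U\<in>C'. real (copies i \<alpha> k U)) - (\<Sum>U\<in>C'. real (copies i \<beta> k U))\<bar>
      \<le> (\<Sum>U\<in>C'. \<bar>real (copies i \<alpha> k U) - real (copies i \<beta> k U)\<bar>)"
    unfolding sum_subtractf [symmetric] by (rule sum_abs)
  also have "\<dots> \<le> (\<Sum>U\<in>C'. \<delta> * ((infl ^ k)\<^sup>2 * area U))"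
    using C'(3) \<delta> by (intro sum_mono) blast
  also have "\<dots> = \<delta> * ((infl ^ k)\<^sup>2 * (\<Sum>U\<in>C'. area U))"
    by (simp add: sum_distrib_left)
  \<comment> \<open>The tiles of C' are measured before inflation, hence in a disc of radius
    \<open>r / infl ^ k\<close>.\<close>
  also have "\<dots> \<le> \<delta> * ((infl ^ k)\<^sup>2 * (pi * (r / infl ^ k)\<^sup>2))"
  proof -
    have "interior (snd U) \<subseteq> cball 0 (r / infl ^ k)" if "U \<in> C'" for U
    proof
      fix x assume "x \<in> interior (snd U)"
      then have "infl ^ k *\<^sub>R x \<in> cball 0 r"
        using that interior_subset unfolding C'_def by blast
      then show "x \<in> cball 0 (r / infl ^ k)"
        using infl_power_pos [of k] by (simp add: pos_le_divide_eq mult.commute)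
    qed
    from sum_area_le [OF C' lmeasurable_cball this]
    have "(\<Sum>U\<in>C'. area U) \<le> measure lebesgue (cball (0::real^2) (r / infl ^ k))" .
    also have "\<dots> = pi * (r / infl ^ k)\<^sup>2"
      using \<open>0 \<le> r\<close> infl_power_pos [of k] by (intro measure_cball_plane) simp
    finally show ?thesis
      using \<open>0 \<le> \<delta>\<close> by (intro mult_left_mono) auto
  qed
  also have "\<dots> = \<delta> * (pi * r\<^sup>2)"
    using infl_gt_1 by (simp add: power_divide)
  finally have "\<bar>(\<Sum>U\<in>C'. real (copies i \<alpha> k U)) - (\<Sum>U\<in>C'. real (copies i \<beta> k U))\<bar> \<le> \<delta> * (pi * r\<^sup>2)" .
  \<comment> \<open>Both remaining counts lie between 0 and \<open>card (B - I)\<close>, so the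
    annulus enters only once.\<close>
  then show ?thesis
    using split [of \<alpha>] split [of \<beta>] rest [of \<alpha>] rest [of \<beta>] card_annulus
    unfolding B_def [symmetric] Q_def [symmetric] by (simp add: abs_le_iff)
qed

text \<open>The tiles in the ball cover the ball of radius r - d, and each lies in a disc of radius
  d. As this is a covering argument, it measures whole tiles instead of interiors.\<close>

lemma card_tiles_in_ball_ge:
  fixes d r :: real
  assumes \<T>: "is_tiling P \<T>"
    and d: "d > 0" "\<And>T x y. is_tile P T \<Longrightarrow> x \<in> snd T \<Longrightarrow> y \<in> snd T \<Longrightarrow> dist x y \<le> d"
    and "d \<le> r"
  shows "(r - d)\<^sup>2 \<le> card (tiles_in_ball \<T> r) * d\<^sup>2"
proof -
  let ?B = "tiles_in_ball \<T> r"
  have tiling: "\<And>T. T \<in> \<T> \<Longrightarrow> is_tile P T" "(\<Union>T\<in>\<T>. snd T) = UNIV" "nonoverlapping \<T>"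
    using \<T> unfolding is_tiling_def by blast+
  have "?B \<subseteq> \<T>"
    by (auto simp: tiles_in_ball_def)
  have tB: "is_tile P T" if "T \<in> ?B" for T
    using tiling(1) \<open>?B \<subseteq> \<T>\<close> that by (meson subsetD)
  have "finite ?B"
    using nonoverlapping_subset [OF tiling(3) \<open>?B \<subseteq> \<T>\<close>] tB
    by (rule finite_tiles_bounded [of _ r]) (simp_all add: tiles_in_ball_def)
  have m: "snd T \<in> lmeasurable" if "T \<in> ?B" for T
    using compact_tile [OF tB [OF that]] by (rule lmeasurable_compact)
  have le: "measure lebesgue (snd T) \<le> pi * d\<^sup>2" if T: "T \<in> ?B" for T
  proof -
    obtain x where "x \<in> snd T"
      using interior_tile_nonempty [OF tB [OF T]] interior_subset by blast
    then have "snd T \<subseteq> cball x d"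
      using d(2) [OF tB [OF T]] by auto
    then have "measure lebesgue (snd T) \<le> measure lebesgue (cball x d)"
      using m [OF T] by (intro measure_mono_fmeasurable fmeasurableD lmeasurable_cball)
    then show ?thesis
      using d(1) by (simp only: measure_cball_plane less_imp_le)
  qed
  have "cball 0 (r - d) \<subseteq> (\<Union>T\<in>?B. snd T)"
  proof
    fix x :: "real^2" assume x: "x \<in> cball 0 (r - d)"
    obtain T where T: "T \<in> \<T>" "x \<in> snd T"
      using tiling(2) by blast
    have "snd T \<subseteq> cball 0 r"
    proof
      fix y assume "y \<in> snd T"
      then have "dist x y \<le> d"
        using d(2) tiling(1) T by blast
      moreover have "norm y \<le> norm x + dist x y"
        by (rule norm_le_norm_add_dist)
      ultimately show "y \<in> cball 0 r"
        using x by simp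
    qed
    then show "x \<in> (\<Union>T\<in>?B. snd T)"
      using T unfolding tiles_in_ball_def by blast
  qed
  then have "measure lebesgue (cball (0::real^2) (r - d)) \<le> measure lebesgue (\<Union>T\<in>?B. snd T)"
    using \<open>finite ?B\<close> m
    by (intro measure_mono_fmeasurable fmeasurableD lmeasurable_cball fmeasurable.finite_UN)
  also have "\<dots> \<le> (\<Sum>T\<in>?B. measure lebesgue (snd T))"
    using \<open>finite ?B\<close> m by (intro measure_UNION_le fmeasurableD)
  also have "\<dots> \<le> (\<Sum>T\<in>?B. pi * d\<^sup>2)"
    using le by (rule sum_mono)
  finally have "pi * (r - d)\<^sup>2 \<le> pi * (card ?B * d\<^sup>2)"
    using measure_cball_plane [of "r - d" 0] \<open>d \<le> r\<close> by (simp add: mult_ac)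
  then show ?thesis
    by simp
qed

lemma freq_diff_tendsto_0:
  assumes \<T>: "\<T> \<in> substitution_tilings P \<sigma>" and "recurrent_angle (\<alpha> - \<beta>)"
  shows "((\<lambda>r. real (card {T \<in> tiles_in_ball \<T> r. \<exists>t. T = move \<alpha> t (prototile P i)})
        / real (card (tiles_in_ball \<T> r))
      - real (card {T \<in> tiles_in_ball \<T> r. \<exists>t. T = move \<beta> t (prototile P i)})
        / real (card (tiles_in_ball \<T> r))) \<longlongrightarrow> 0) at_top"
proof (rule tendstoI)
  fix \<eta> :: real assume "\<eta> > 0"
  let ?c = "\<lambda>\<gamma> r. real (card {T \<in> tiles_in_ball \<T> r. \<exists>t. T = move \<gamma> t (prototile P i)})"
  let ?n = "\<lambda>r. real (card (tiles_in_ball \<T> r))"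
  obtain d where d: "d > 0" "\<And>T x y. is_tile P T \<Longrightarrow> x \<in> snd T \<Longrightarrow> y \<in> snd T \<Longrightarrow> dist x y \<le> d"
    using tile_diameter by metis
  obtain a b where a: "0 < a" "\<And>T. is_tile P T \<Longrightarrow> a \<le> area T \<and> area T \<le> b"
    using area_bounds by metis
  \<comment> \<open>The ball will contain at least r^2 / (4 * d^2) tiles. This choice keeps the
    supertile term below \<eta> / 2 times that number; the boundary term, linear in r, is handled by
    the third bound on r below.\<close>
  define \<epsilon> where "\<epsilon> = \<eta> / (8 * d\<^sup>2 * pi)"
  have "\<epsilon> > 0"
    using \<open>\<eta> > 0\<close> d(1) by (simp add: \<epsilon>_def)
  then have "\<forall>\<^sub>F k in sequentially. dev i \<alpha> (\<alpha> - \<beta>) k < \<epsilon>"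
    using dev_tendsto_0 [OF assms(2)] by (rule order_tendstoD(2) [rotated])
  then obtain k where k: "dev i \<alpha> (\<alpha> - \<beta>) k < \<epsilon>"
    unfolding eventually_sequentially by blast
  define \<delta> where "\<delta> = dev i \<alpha> (\<alpha> - \<beta>) k"
  have "0 \<le> \<delta>"
    unfolding \<delta>_def by (rule dev_nonneg)
  have \<delta>: "\<bar>real (copies i \<alpha> k U) - real (copies i \<beta> k U)\<bar> \<le> \<delta> * ((infl ^ k)\<^sup>2 * area U)"
    if U: "is_tile P U" for U
  proof -
    have pos: "(infl ^ k)\<^sup>2 * area U > 0"
      by (intro mult_pos_pos zero_less_power infl_power_pos area_pos U)
    \<comment> \<open>Turning U through \<alpha> - \<beta> changes its density for \<alpha> into the
      one for \<beta>.\<close>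
    have "\<bar>density i \<beta> k U - density i \<alpha> k U\<bar> \<le> \<delta>"
      using le_dev [OF U, of i \<alpha> k "\<alpha> - \<beta>" 0] by (simp add: density_move U \<delta>_def)
    then have "\<bar>density i \<alpha> k U - density i \<beta> k U\<bar> * ((infl ^ k)\<^sup>2 * area U)
        \<le> \<delta> * ((infl ^ k)\<^sup>2 * area U)"
      using pos by (intro mult_right_mono) (simp_all add: abs_minus_commute)
    also have "\<bar>density i \<alpha> k U - density i \<beta> k U\<bar> * ((infl ^ k)\<^sup>2 * area U)
        = \<bar>(density i \<alpha> k U - density i \<beta> k U) * ((infl ^ k)\<^sup>2 * area U)\<bar>"
      unfolding abs_mult [of _ "(infl ^ k)\<^sup>2 * area U"] abs_of_pos [OF pos] by (rule refl)
    also have "(density i \<alpha> k U - density i \<beta> k U) * ((infl ^ k)\<^sup>2 * area U)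
        = real (copies i \<alpha> k U) - real (copies i \<beta> k U)"
      using pos unfolding density_def diff_divide_distrib [symmetric]
      by (metis less_irrefl nonzero_eq_divide_eq)
    finally show ?thesis .
  qed
  define D where "D = infl ^ k * d"
  have "0 \<le> D"
    using d(1) infl_power_pos [of k] by (simp add: D_def)
  define c where "c = 2 * pi * D / a"
  have "0 \<le> c"
    using \<open>0 \<le> D\<close> a(1) by (simp add: c_def)
  have "\<bar>?c \<alpha> r / ?n r - ?c \<beta> r / ?n r\<bar> < \<eta>" if r: "2 * d \<le> r" "D \<le> r" "8 * d\<^sup>2 * c / \<eta> \<le> r" for r
  proof -
    have "r > 0"
      using r(1) d(1) by simp
    have diff: "\<bar>?c \<alpha> r - ?c \<beta> r\<bar> \<le> \<delta> * (pi * r\<^sup>2) + c * r"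
      unfolding c_def using \<T> d(2) a \<delta> D_def \<open>0 \<le> D\<close> r(2) \<open>0 \<le> \<delta>\<close>
      by (intro copies_in_ball_diff [where d = d]) auto
    have "(r / 2)\<^sup>2 \<le> (r - d)\<^sup>2"
      using r(1) \<open>r > 0\<close> by (intro power_mono) auto
    also have "\<dots> \<le> ?n r * d\<^sup>2"
      using \<T> d r(1) by (intro card_tiles_in_ball_ge) (auto simp: substitution_tilings_def)
    finally have n: "r\<^sup>2 / (4 * d\<^sup>2) \<le> ?n r"
      using d(1) by (simp add: power_divide pos_divide_le_eq mult_ac)
    have "r\<^sup>2 / (4 * d\<^sup>2) > 0"
      using \<open>r > 0\<close> d(1) by simp
    then have "?n r > 0"
      using n by linarith
    have 1: "\<delta> * (pi * r\<^sup>2) < \<eta> / 2 * (r\<^sup>2 / (4 * d\<^sup>2))"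
    proof -
      have "\<delta> * (pi * r\<^sup>2) < \<epsilon> * (pi * r\<^sup>2)"
        using k \<open>r > 0\<close> unfolding \<delta>_def by (intro mult_strict_right_mono) simp_all
      also have "\<dots> = \<eta> / 2 * (r\<^sup>2 / (4 * d\<^sup>2))"
        unfolding \<epsilon>_def by (simp add: field_simps)
      finally show ?thesis .
    qed
    have 2: "c * r \<le> \<eta> / 2 * (r\<^sup>2 / (4 * d\<^sup>2))"
    proof -
      have "8 * d\<^sup>2 * c \<le> \<eta> * r"
        using r(3) \<open>\<eta> > 0\<close> by (simp add: pos_divide_le_eq mult_ac)
      then have "8 * d\<^sup>2 * c * r \<le> \<eta> * r * r"
        using \<open>r > 0\<close> by (intro mult_right_mono) simp_all
      then show ?thesis
        using d(1) by (simp add: pos_le_divide_eq power2_eq_square mult_ac)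
    qed
    have "\<bar>?c \<alpha> r - ?c \<beta> r\<bar> < \<eta> * (r\<^sup>2 / (4 * d\<^sup>2))"
      using diff 1 2 by linarith
    also have "\<dots> \<le> \<eta> * ?n r"
      using n \<open>\<eta> > 0\<close> by (intro mult_left_mono) simp_all
    finally have "\<bar>?c \<alpha> r - ?c \<beta> r\<bar> / ?n r < \<eta>"
      using \<open>?n r > 0\<close> by (simp only: pos_divide_less_eq)
    then show ?thesis
      unfolding diff_divide_distrib [symmetric] abs_divide using \<open>?n r > 0\<close> by simp
  qed
  then show "\<forall>\<^sub>F r in at_top. dist (?c \<alpha> r / ?n r - ?c \<beta> r / ?n r) 0 < \<eta>"
    unfolding dist_real_def diff_0_right
    by (intro eventually_at_top_linorderI [of "max (2 * d) (max D (8 * d\<^sup>2 * c / \<eta>))"]) simp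
qed

text \<open>The two copies form a finite patch, so one supertile contains both in moved form. Since
  rotations commute, they still differ by the angle \<alpha> - \<beta>.\<close>

lemma recurrent_angle_tiling:
  assumes \<T>: "\<T> \<in> substitution_tilings P \<sigma>"
    and "move \<alpha> s (prototile P i) \<in> \<T>" "move \<beta> t (prototile P i) \<in> \<T>"
  shows "recurrent_angle (\<alpha> - \<beta>)"
proof -
  let ?S = "move \<alpha> s (prototile P i)" and ?T = "move \<beta> t (prototile P i)"
  obtain j n \<gamma> u where "move \<gamma> u ` {?S, ?T} \<subseteq> supertile P \<sigma> n j"
    using assms by (auto intro: substitution_tilings_supertile [of \<T> P \<sigma> "{?S, ?T}"])
  then have *: "move \<gamma> u ?S \<in> iter n (prototile P j)" "move \<gamma> u ?T \<in> iter n (prototile P j)"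
    by (simp_all add: supertile_def iter_def)
  have "move \<gamma> u ?S = move (\<alpha> - \<beta>)
      (rotation \<gamma> s + u - rotation (\<alpha> - \<beta>) (rotation \<gamma> t + u)) (move \<gamma> u ?T)"
    by (simp add: move_move add.commute)
  then show ?thesis
    using recurrent_angleI [OF *(2)] *(1) by metis
qed

end

section \<open>Conclusion for frequencies\<close>

text \<open>All tiles in a supertile of an empty prototile are empty. By primitivity one of them has
  the type of a tile of \<T> that contains the origin.\<close>

lemma primitive_prototile_nonempty:
  assumes "substitution P infl \<sigma>" and "primitive P \<sigma>" and "is_tiling P \<T>"
  shows "P i \<noteq> {}"
proof
  interpret substitution P infl \<sigma> by fact
  assume "P i = {}"
  have "(\<Union>T\<in>\<T>. snd T) = UNIV" "\<And>T. T \<in> \<T> \<Longrightarrow> is_tile P T"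
    using assms(3) by (auto simp: is_tiling_def)
  then obtain T where T: "is_tile P T" "0 \<in> snd T"
    by blast
  obtain m where "(((**) (substitution_matrix P \<sigma>) ^^ m) (mat 1)) $ (fst T) $ i > 0"
    using assms(2) unfolding primitive_def by blast
  then obtain X where X: "X \<in> iter m (prototile P i)" "fst X = fst T"
    using matrix_power_pos_imp_iter [OF assms(1)] by blast
  have "snd X = {}"
    using snd_iter_subset [OF is_tile_prototile X(1)] \<open>P i = {}\<close> by (simp add: prototile_def)
  moreover obtain \<alpha> s where "snd X = (\<lambda>x. rotation \<alpha> x + s) ` P (fst X)"
    using is_tile_iter [OF is_tile_prototile X(1)] by (rule snd_tile_cases)
  ultimately have "P (fst T) = {}"
    using X(2) by simp
  moreover obtain \<beta> t where "snd T = (\<lambda>x. rotation \<beta> x + t) ` P (fst T)"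
    using T(1) by (rule snd_tile_cases)
  ultimately show False
    using T(2) by simp
qed

text \<open>Without such a copy every count is 0, and so is every quotient, including those for
  balls that contain no tile, where 0 is divided by 0.\<close>

lemma freq_nonzero_imp_tile:
  assumes "freq P i \<alpha> \<T> \<noteq> 0"
  shows "\<exists>t. move \<alpha> t (prototile P i) \<in> \<T>"
proof (rule ccontr)
  assume "\<not> (\<exists>t. move \<alpha> t (prototile P i) \<in> \<T>)"
  then have "{T \<in> tiles_in_ball \<T> r. \<exists>t. T = move \<alpha> t (prototile P i)} = {}" for r
    by (auto simp: tiles_in_ball_def)
  then have "freq P i \<alpha> \<T> = Lim at_top (\<lambda>r::real. 0 :: real)"
    by (simp only: freq_def card.empty of_nat_0 div_0)
  also have "\<dots> = 0"
    by (rule tendsto_Lim) auto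
  finally show False
    using assms by contradiction
qed

theorem theorem2p3:
  fixes P :: "'m::finite \<Rightarrow> (real^2) set"
    and infl :: real
    and \<sigma> :: "'m tile \<Rightarrow> 'm tile set"
    and \<T> :: "'m tile set"
    and i :: 'm
    and \<alpha> \<beta> :: real
  assumes "substitution P infl \<sigma>"
    and "primitive P \<sigma>"
    and "\<T> \<in> substitution_tilings P \<sigma>"
    and "\<alpha> \<in> {0..<2*pi}" and "\<beta> \<in> {0..<2*pi}"
    and "freq P i \<alpha> \<T> \<noteq> 0" and "freq P i \<beta> \<T> \<noteq> 0"
  shows "freq P i \<alpha> \<T> = freq P i \<beta> \<T>"
proof -
  have "is_tiling P \<T>"
    using assms(3) by (simp add: substitution_tilings_def)
  interpret primitive_substitution P infl \<sigma>
    using assms(1,2) primitive_prototile_nonempty [OF assms(1,2) \<open>is_tiling P \<T>\<close>]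
    by (simp add: primitive_substitution_def primitive_substitution_axioms_def)
  have "recurrent_angle (\<alpha> - \<beta>)"
    using freq_nonzero_imp_tile [OF assms(6)] freq_nonzero_imp_tile [OF assms(7)]
      recurrent_angle_tiling [OF assms(3)] by blast
  \<comment> \<open>The two quotients converge to the same numbers, so the descriptions that define
    the two values of \<open>Lim\<close> are equal whether or not a limit exists.\<close>
  from Lim_transform_eq [OF freq_diff_tendsto_0 [OF assms(3) this]] show ?thesis
    unfolding freq_def t2_space_class.Lim_def by (simp only:)
qed

end
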